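(* Let $q>1$ be a real number which is not a Pisot number. Then $\ell^{2m}(q)=0$ and $L^{3m}(q)=0$ for every positive integer $m$ satisfying $m>q-1$.
   Context: For a real number $q>1$ and a positive integer $m$, let $X^m(q)=\left\{\sum_{i=0}^n s_iq^i : n\in\{0,1,2,\ldots\},\ s_i\in\{0,1,\ldots,m\}\right\}$. This is an unbounded set of nonnegative reals having only finitely many elements in each bounded interval, so its elements can be arranged into a strictly increasing sequence $0=x_0^m(q)<x_1^m(q)<x_2^m(q)<\cdots$. Define $\ell^m(q)=\liminf_{k\to\infty}(x_{k+1}^m(q)-x_k^m(q))$ and $L^m(q)=\limsup_{k\to\infty}(x_{k+1}^m(q)-x_k^m(q))$. A Pisot number is a real algebraic integer $>1$ all of whose other algebraic conjugates have modulus strictly less than one. *)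

theory Defs
  imports "HOL-Analysis.Analysis" "HOL-Computational_Algebra.Polynomial"
begin

definition spectrum_set :: "nat \<Rightarrow> real \<Rightarrow> real set" where
  "spectrum_set m q = {(\<Sum>i\<le>n. real (s i) * q ^ i) | (n::nat) (s :: nat \<Rightarrow> nat). \<forall>i\<le>n. s i \<le> m}"

text \<open>The description below determines the sequence uniquely whenever \<open>q > 1\<close> and \<open>m > 0\<close>; see
  \<open>spectrum_seq_unique\<close>.\<close>

definition spectrum_seq :: "nat \<Rightarrow> real \<Rightarrow> nat \<Rightarrow> real" where
  "spectrum_seq m q = (THE x. strict_mono x \<and> range x = spectrum_set m q)"

text \<open>The limits are taken in the extended reals, because \<open>upper_gap\<close> may be infinite when \<open>m < q - 1\<close>.\<close>

definition lower_gap :: "nat \<Rightarrow> real \<Rightarrow> ereal" where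
  "lower_gap m q = liminf (\<lambda>k. ereal (spectrum_seq m q (Suc k) - spectrum_seq m q k))"

definition upper_gap :: "nat \<Rightarrow> real \<Rightarrow> ereal" where
  "upper_gap m q = limsup (\<lambda>k. ereal (spectrum_seq m q (Suc k) - spectrum_seq m q k))"

text \<open>Conjugacy over the rationals: \<open>p\<close> is the minimal polynomial of \<open>x\<close>.\<close>

definition algebraic_conjugate :: "complex \<Rightarrow> complex \<Rightarrow> bool" where
  "algebraic_conjugate x z \<longleftrightarrow>
     (\<exists>p :: rat poly. irreducible p \<and> lead_coeff p = 1 \<and>
        poly (map_poly of_rat p) x = 0 \<and> poly (map_poly of_rat p) z = 0)"

definition Pisot_number :: "real \<Rightarrow> bool" where
  "Pisot_number q \<longleftrightarrow> q > 1 \<and> algebraic_int q \<and>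
     (\<forall>z. algebraic_conjugate (of_real q) z \<and> z \<noteq> of_real q \<longrightarrow> cmod z < 1)"

lemma strict_mono_enumeration_unique:
  fixes S :: "real set"
  assumes inf: "infinite S" and fin: "\<And>b. finite (S \<inter> {..b})"
  shows "\<exists>!x :: nat \<Rightarrow> real. strict_mono x \<and> range x = S"
proof -
  have least: "\<exists>y\<in>S. P y \<and> (\<forall>z\<in>S. P z \<longrightarrow> y \<le> z)" if "b \<in> S" "P b" for P b
  proof -
    let ?T = "{y \<in> S \<inter> {..b}. P y}"
    have T: "finite ?T" "b \<in> ?T" using finite_subset[OF _ fin[of b], of ?T] that by blast+
    have M: "Min ?T \<in> ?T" using T by (intro Min_in) auto
    have "Min ?T \<le> z" if "z \<in> S" "P z" for z
    proof (cases "z \<le> b")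
      case True
      then show ?thesis using that T by (intro Min_le) auto
    next
      case False
      then show ?thesis using M by auto
    qed
    then show ?thesis using M by blast
  qed
  have above: "\<exists>b\<in>S. a < b" for a
  proof (rule ccontr)
    assume "\<not> ?thesis"
    then have "S \<inter> {..a} = S" by (auto simp: not_less)
    then show False using fin[of a] inf by simp
  qed
  obtain nxt where nxt: "\<And>a. nxt a \<in> S" "\<And>a. a < nxt a" "\<And>a z. z \<in> S \<Longrightarrow> a < z \<Longrightarrow> nxt a \<le> z"
  proof -
    have "\<forall>a. \<exists>y\<in>S. a < y \<and> (\<forall>z\<in>S. a < z \<longrightarrow> y \<le> z)"
      using least[where P = "\<lambda>y. _ < y"] above by blast
    then show ?thesis using that by metis
  qed
  obtain a0 where a0: "a0 \<in> S" "\<And>z. z \<in> S \<Longrightarrow> a0 \<le> z"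
    using least[where P = "\<lambda>_. True"] above[of 0] by blast
  define x where "x = rec_nat a0 (\<lambda>_. nxt)"
  have x0: "x 0 = a0" and xS: "\<And>n. x (Suc n) = nxt (x n)" by (simp_all add: x_def)
  have mono: "strict_mono x" by (auto simp: strict_mono_Suc_iff xS nxt)
  have in_S: "x n \<in> S" for n by (cases n) (auto simp: x0 xS a0 nxt)
  have "y \<in> range x" if y: "y \<in> S" for y
  proof (rule ccontr)
    assume ny: "y \<notin> range x"
    have "x n < y" for n
    proof (induction n)
      case 0
      have "x 0 \<noteq> y" using ny by blast
      then show ?case using a0(2)[OF y] by (simp add: x0)
    next
      case (Suc n)
      have "x (Suc n) \<noteq> y" using ny by blast
      then show ?case using nxt(3)[OF y Suc] by (simp add: xS)
    qed
    then have "range x \<subseteq> S \<inter> {..y}" using in_S by (auto intro: less_imp_le)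
    then have "finite (range x)" using fin finite_subset by blast
    moreover have "inj x" using mono by (rule strict_mono_imp_inj_on)
    ultimately show False using range_inj_infinite by blast
  qed
  then have ex: "strict_mono x \<and> range x = S" using mono in_S by blast
  have le: "f n \<le> g n"
    if f: "strict_mono f" "range f = S" and g: "strict_mono g" "range g = S"
    for f g :: "nat \<Rightarrow> real" and n
  proof (induction n)
    case 0
    have "g 0 \<in> range f" using f g by blast
    then obtain j where j: "g 0 = f j" by blast
    show ?case unfolding j using f(1) by (simp add: strict_mono_less_eq)
  next
    case (Suc n)
    have "g (Suc n) \<in> range f" using f g by blast
    then obtain j where j: "g (Suc n) = f j" by blast
    have "f n < f j" using Suc g(1) j by (metis le_less_trans lessI strict_mono_less)
    then have "Suc n \<le> j" using f(1) by (simp add: strict_mono_less Suc_le_eq)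
    then show ?case unfolding j using f(1) by (simp add: strict_mono_less_eq)
  qed
  show ?thesis
  proof (rule ex1I[of _ x])
    show "strict_mono x \<and> range x = S" by (rule ex)
  next
    fix g :: "nat \<Rightarrow> real" assume g: "strict_mono g \<and> range g = S"
    show "g = x"
    proof
      fix n
      show "g n = x n" using le[of g x n] le[of x g n] g ex by (simp add: antisym)
    qed
  qed
qed

lemma infinite_spectrum_set:
  assumes "q > 1" "m > 0"
  shows "infinite (spectrum_set m q)"
proof
  assume fin: "finite (spectrum_set m q)"
  have "q ^ n \<in> spectrum_set m q" for n
  proof -
    have "(\<Sum>i\<le>n. real (if i = n then 1 else 0) * q ^ i) = (\<Sum>i\<le>n. if i = n then q ^ i else 0)"
      by (intro sum.cong) auto
    also have "\<dots> = q ^ n" by simp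
    finally show ?thesis
      unfolding spectrum_set_def using assms
      by (intro CollectI exI[of _ n] exI[of _ "\<lambda>i. if i = n then 1 else 0"]) auto
  qed
  then have "finite (range (\<lambda>n::nat. q ^ n))" using fin by (auto intro: finite_subset)
  moreover have "inj (\<lambda>n::nat. q ^ n)" using assms by (auto intro!: injI)
  ultimately show False using range_inj_infinite by blast
qed

lemma finite_spectrum_set_bounded:
  assumes "q > 1"
  shows "finite (spectrum_set m q \<inter> {..b})"
proof -
  obtain N where N: "b < q ^ N" using real_arch_pow assms by blast
  let ?F = "PiE {..N} (\<lambda>_. {..m})"
  have "spectrum_set m q \<inter> {..b} \<subseteq> (\<lambda>s. \<Sum>i\<le>N. real (s i) * q ^ i) ` ?F"
  proof
    fix y assume "y \<in> spectrum_set m q \<inter> {..b}"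
    then obtain n s where y: "y = (\<Sum>i\<le>n. real (s i) * q ^ i)" "y \<le> b" and s: "\<forall>i\<le>n. s i \<le> m"
      unfolding spectrum_set_def by auto
    define t where "t i = (if i \<le> n then s i else 0)" for i
    have z: "t i = 0" if "N < i" for i
    proof (rule ccontr)
      assume "t i \<noteq> 0"
      then have i: "i \<le> n" "s i \<ge> 1" by (auto simp: t_def split: if_splits)
      have "q ^ N \<le> q ^ i" using that assms by (intro power_increasing) auto
      also have "\<dots> \<le> real (s i) * q ^ i" using i assms by simp
      also have "\<dots> \<le> y" unfolding y using i assms by (intro member_le_sum) auto
      finally show False using N y by simp
    qed
    have "y = (\<Sum>i\<le>n. real (t i) * q ^ i)" unfolding y by (intro sum.cong) (auto simp: t_def)
    also have "\<dots> = (\<Sum>i\<le>max n N. real (t i) * q ^ i)"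
      by (intro sum.mono_neutral_left) (auto simp: t_def)
    also have "\<dots> = (\<Sum>i\<le>N. real (t i) * q ^ i)"
      by (intro sum.mono_neutral_right) (auto simp: z)
    also have "\<dots> = (\<Sum>i\<le>N. real (restrict t {..N} i) * q ^ i)" by (intro sum.cong) auto
    finally show "y \<in> (\<lambda>s. \<Sum>i\<le>N. real (s i) * q ^ i) ` ?F"
      using s by (intro image_eqI[of _ _ "restrict t {..N}"]) (auto simp: t_def)
  qed
  then show ?thesis by (rule finite_subset) (intro finite_imageI finite_PiE; simp)
qed

lemma spectrum_seq_unique:
  assumes "q > 1" "m > 0"
  shows "\<exists>!x :: nat \<Rightarrow> real. strict_mono x \<and> range x = spectrum_set m q"
  by (intro strict_mono_enumeration_unique infinite_spectrum_set finite_spectrum_set_bounded assms)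

lemma spectrum_seq:
  assumes "q > 1" "m > 0"
  shows "strict_mono (spectrum_seq m q)" "range (spectrum_seq m q) = spectrum_set m q"
  using theI'[OF spectrum_seq_unique[OF assms]] unfolding spectrum_seq_def by blast+

end

theory Submission
  imports Defs "HOL-Computational_Algebra.Field_as_Ring"
    "HOL-Computational_Algebra.Polynomial_Factorial"
begin

text \<open>
  Let \<open>X\<close> be the spectrum for the digits \<open>0..m\<close>. It suffices that the differences of the spectrum for
  \<open>2m\<close> accumulate at \<open>0\<close>. Otherwise \<open>X - X\<close> is locally finite, also for \<open>m = \<lfloor>q\<rfloor>\<close>, and repeated
  remainders in an expansion of \<open>1\<close> show that \<open>q\<close> is an algebraic integer. Suppose it has a conjugate
  \<open>p \<noteq> q\<close> with \<open>\<bar>p\<bar> \<ge> 1\<close>.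

  Call \<open>\<delta>\<close> an admissible period if the numbers \<open>q ^ n * \<delta> + y\<close>, where \<open>y\<close> is a difference of two digit
  sums of length \<open>n\<close>, form a locally finite set. If \<open>t\<close> and \<open>1 - t\<close> are admissible and \<open>t\<close> is irrational,
  Euclid's algorithm yields arbitrarily small admissible periods. Let \<open>z\<close> be the first remainder below
  \<open>m / q\<close> of the greedy expansion of \<open>1\<close>, and \<open>t\<close> the fractional part of \<open>q z\<close>; then \<open>t\<close> and \<open>1 - t\<close> are
  admissible. If \<open>t\<close> is rational, then \<open>p\<close> is a root of a polynomial with decreasing coefficients, the
  greedy remainders, so \<open>\<bar>p\<bar> < 1\<close> by Enestrom--Kakeya. If \<open>t\<close> is irrational, expand a small admissible
  period \<open>\<delta>\<close> as \<open>\<Sum>d\<^sub>i q\<^bsup>-i\<^esup>\<close> with the sign of each digit \<open>d\<^sub>i\<close> chosen such that all \<open>Re (a d\<^sub>i p\<^bsup>-i\<^esup>)\<close> have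
  the sign opposite to \<open>Re (a \<delta>')\<close>, where \<open>\<delta>'\<close> is the conjugate of \<open>\<delta>\<close>. The remainders of this expansion
  have bounded conjugates, which bounds a sum without cancellation that has to diverge. The case of a
  positive real \<open>p\<close> is direct.
\<close>

subsection \<open>Digit sums\<close>

text \<open>The range \<open>i < n\<close> makes \<open>n\<close> the number of digits:
  concatenation multiplies the second value by exactly \<open>q ^ n\<close>, and length 0 gives
  \<open>{0}\<close>.\<close>

definition digit_sums :: "nat \<Rightarrow> real \<Rightarrow> nat \<Rightarrow> real set" where
  "digit_sums m q n = {(\<Sum>i<n. real (s i) * q ^ i) | s :: nat \<Rightarrow> nat. \<forall>i. s i \<le> m}"

definition digit_diffs :: "nat \<Rightarrow> real \<Rightarrow> nat \<Rightarrow> real set" where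
  "digit_diffs m q n = {a - b | a b. a \<in> digit_sums m q n \<and> b \<in> digit_sums m q n}"

lemma digit_sums_0 [simp]: "digit_sums m q 0 = {0}"
  by (auto simp: digit_sums_def intro: exI[of _ "\<lambda>_. 0"])

lemma digit_sums_append:
  assumes "a \<in> digit_sums m q n" "b \<in> digit_sums m q k"
  shows "a + q ^ n * b \<in> digit_sums m q (n + k)"
proof -
  obtain s where s: "a = (\<Sum>i<n. real (s i) * q ^ i)" "\<forall>i. s i \<le> m"
    using assms(1) unfolding digit_sums_def by blast
  obtain t where t: "b = (\<Sum>i<k. real (t i) * q ^ i)" "\<forall>i. t i \<le> m"
    using assms(2) unfolding digit_sums_def by blast
  define u where "u i = (if i < n then s i else t (i - n))" for i
  have "(\<Sum>i<n + k. real (u i) * q ^ i) = (\<Sum>i<n. real (u i) * q ^ i) + (\<Sum>i<k. real (u (n + i)) * q ^ (n + i))"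
    by (induction k) (simp_all add: add.assoc)
  also have "\<dots> = a + q ^ n * b"
    unfolding s(1) t(1) by (simp add: u_def sum_distrib_left power_add mult_ac)
  finally show ?thesis
    unfolding digit_sums_def using s(2) t(2) by (intro CollectI exI[of _ u]) (auto simp: u_def)
qed

lemma digit_sums_single: "d \<le> m \<Longrightarrow> real d \<in> digit_sums m q (Suc 0)"
  by (auto simp: digit_sums_def intro: exI[of _ "\<lambda>_. d"])

lemma digit_sums_zero: "0 \<in> digit_sums m q n"
  by (auto simp: digit_sums_def intro!: exI[of _ "\<lambda>_. 0"])

lemma digit_sums_mono:
  assumes "n \<le> k" shows "digit_sums m q n \<subseteq> digit_sums m q k"
proof
  fix a assume "a \<in> digit_sums m q n"
  from digit_sums_append[OF this digit_sums_zero[of m q "k - n"]] assms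
  show "a \<in> digit_sums m q k" by simp
qed

lemma digit_sums_add:
  assumes "a \<in> digit_sums m q n" "b \<in> digit_sums k q n"
  shows "a + b \<in> digit_sums (m + k) q n"
proof -
  obtain s where s: "a = (\<Sum>i<n. real (s i) * q ^ i)" "\<forall>i. s i \<le> m"
    using assms(1) unfolding digit_sums_def by blast
  obtain t where t: "b = (\<Sum>i<n. real (t i) * q ^ i)" "\<forall>i. t i \<le> k"
    using assms(2) unfolding digit_sums_def by blast
  show ?thesis unfolding digit_sums_def
    using s t by (intro CollectI exI[of _ "\<lambda>i. s i + t i"]) (auto simp: sum.distrib ring_distribs intro: add_mono)
qed

lemma digit_sums_le_digits: "m \<le> k \<Longrightarrow> digit_sums m q n \<subseteq> digit_sums k q n"
  unfolding digit_sums_def by (blast intro: order_trans)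

lemma spectrum_set_eq: "spectrum_set m q = (\<Union>n. digit_sums m q n)"
proof (intro equalityI subsetI)
  fix x assume "x \<in> spectrum_set m q"
  then obtain n s where x: "x = (\<Sum>i\<le>n. real (s i) * q ^ i)" "\<forall>i\<le>n. s i \<le> m"
    unfolding spectrum_set_def by blast
  have "x = (\<Sum>i<Suc n. real (if i \<le> n then s i else 0) * q ^ i)"
    unfolding x(1) lessThan_Suc_atMost by (intro sum.cong) auto
  then have "x \<in> digit_sums m q (Suc n)"
    unfolding digit_sums_def using x(2) by (intro CollectI exI[of _ "\<lambda>i. if i \<le> n then s i else 0"]) auto
  then show "x \<in> (\<Union>n. digit_sums m q n)" by blast
next
  fix x assume "x \<in> (\<Union>n. digit_sums m q n)"
  then obtain n where "x \<in> digit_sums m q n" by blast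
  then have "x \<in> digit_sums m q (Suc n)" using digit_sums_mono[of n "Suc n"] by auto
  then obtain s where "x = (\<Sum>i\<le>n. real (s i) * q ^ i)" "\<forall>i. s i \<le> m"
    unfolding digit_sums_def lessThan_Suc_atMost by blast
  then show "x \<in> spectrum_set m q" unfolding spectrum_set_def by blast
qed

section \<open>Size of digit sums and greedy expansions\<close>

lemma digit_sums_bounds:
  assumes "q > 1" "a \<in> digit_sums m q n"
  shows "0 \<le> a" "a \<le> q ^ n * (real m / (q - 1))"
proof -
  obtain s where s: "a = (\<Sum>i<n. real (s i) * q ^ i)" "\<forall>i. s i \<le> m"
    using assms(2) unfolding digit_sums_def by blast
  show "0 \<le> a" unfolding s using assms by (intro sum_nonneg) auto
  have "a \<le> (\<Sum>i<n. real m * q ^ i)"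
    unfolding s using assms s(2) by (intro sum_mono mult_right_mono) auto
  also have "\<dots> = real m * ((q ^ n - 1) / (q - 1))"
    using assms by (simp add: sum_distrib_left[symmetric] geometric_sum)
  also have "\<dots> \<le> real m * (q ^ n / (q - 1))"
    using assms by (intro mult_left_mono divide_right_mono) auto
  finally show "a \<le> q ^ n * (real m / (q - 1))" by (simp add: mult_ac)
qed

text \<open>With \<open>M = m / (q - 1)\<close> one has \<open>q * M = M + m\<close> and
  \<open>M \<ge> 1\<close>, so the translates of \<open>[0, M]\<close> by the digits cover
  \<open>[0, q * M]\<close>: the floor is a suitable digit below \<open>m + 1\<close>, and
  \<open>m\<close> from there on.\<close>

lemma digit_step:
  assumes "q > 1" "real m \<ge> q - 1" "0 \<le> y" "y \<le> q * (real m / (q - 1))"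
  shows "\<exists>d\<le>m. 0 \<le> y - real d \<and> y - real d \<le> real m / (q - 1)"
proof (cases "y < real m + 1")
  case True
  have "real (nat \<lfloor>y\<rfloor>) = of_int \<lfloor>y\<rfloor>" using assms by simp
  moreover have "of_int \<lfloor>y\<rfloor> \<le> y" "y - of_int \<lfloor>y\<rfloor> < 1" by linarith+
  moreover have "1 \<le> real m / (q - 1)" using assms by simp
  moreover have "nat \<lfloor>y\<rfloor> \<le> m" using True by linarith
  ultimately show ?thesis by (intro exI[of _ "nat \<lfloor>y\<rfloor>"]) simp
next
  case False
  have "q * (real m / (q - 1)) = real m / (q - 1) + real m"
    using assms by (simp add: field_simps)
  with False assms show ?thesis by (intro exI[of _ m]) auto
qed

text \<open>Digits are chosen from the highest position downwards; before the lowest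
  \<open>n\<close> digits are fixed, the remainder lies in
  \<open>[0, q ^ n * m / (q - 1)]\<close>.\<close>

lemma digit_approx:
  assumes "q > 1" "real m \<ge> q - 1" "0 \<le> x" "x \<le> q ^ n * (real m / (q - 1))"
  shows "\<exists>w\<in>digit_sums m q n. 0 \<le> x - w \<and> x - w \<le> real m / (q - 1)"
  using assms(3,4)
proof (induction n arbitrary: x)
  case 0
  then show ?case by simp
next
  case (Suc n)
  have "0 \<le> x / q ^ n" "x / q ^ n \<le> q * (real m / (q - 1))"
    using Suc.prems assms(1) by (auto simp: pos_divide_le_eq mult_ac)
  from digit_step[OF assms(1,2) this] obtain d where
    d: "d \<le> m" "0 \<le> x / q ^ n - real d" "x / q ^ n - real d \<le> real m / (q - 1)" by blast
  have "x - real d * q ^ n = q ^ n * (x / q ^ n - real d)" using assms(1) by (simp add: field_simps)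
  then have "0 \<le> x - real d * q ^ n" "x - real d * q ^ n \<le> q ^ n * (real m / (q - 1))"
    using d assms(1) by (simp, simp only: mult_left_mono zero_le_power order.strict_implies_order[OF less_trans[OF zero_less_one assms(1)]])
  from Suc.IH[OF this] obtain w where
    w: "w \<in> digit_sums m q n" "0 \<le> x - real d * q ^ n - w" "x - real d * q ^ n - w \<le> real m / (q - 1)"
    by blast
  have "w + q ^ n * real d \<in> digit_sums m q (Suc n)"
    using digit_sums_append[OF w(1) digit_sums_single[OF d(1)]] by simp
  with w show ?case by (intro bexI[of _ "w + q ^ n * real d"]) (auto simp: algebra_simps)
qed

lemma spectrum_approx:
  assumes "q > 1" "real m \<ge> q - 1" "m > 0" "0 \<le> x"
  shows "\<exists>n. \<exists>w\<in>digit_sums m q n. 0 \<le> x - w \<and> x - w \<le> real m / (q - 1)"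
proof -
  obtain n where "x / (real m / (q - 1)) < q ^ n" using real_arch_pow assms(1) by blast
  then have "x \<le> q ^ n * (real m / (q - 1))" using assms by (simp add: field_simps)
  from digit_approx[OF assms(1,2,4) this] show ?thesis by blast
qed

text \<open>The \<open>z n\<close> are the rescaled remainders when \<open>x\<close> is expanded as
  the sum of the \<open>e n / q ^ Suc n\<close>.\<close>

lemma digit_expansion:
  assumes "q > 1" "real m \<ge> q - 1" "0 \<le> x" "x \<le> real m / (q - 1)"
  shows "\<exists>(z :: nat \<Rightarrow> real) (e :: nat \<Rightarrow> nat). z 0 = x \<and>
    (\<forall>n. z (Suc n) = q * z n - real (e n) \<and> e n \<le> m \<and> 0 \<le> z n \<and> z n \<le> real m / (q - 1))"
proof -
  let ?M = "real m / (q - 1)"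
  have "\<exists>z. z 0 = x \<and> (\<forall>n. 0 \<le> z n \<and> z n \<le> ?M \<and> (\<exists>d\<le>m. z (Suc n) = q * z n - real d))"
  proof -
    have "\<exists>y'. (0 \<le> y' \<and> y' \<le> ?M) \<and> (\<exists>d\<le>m. y' = q * y - real d)" if y: "0 \<le> y \<and> y \<le> ?M" for y
      using digit_step[OF assms(1,2), of "q * y"] y assms(1)
      by (metis less_eq_real_def less_trans mult_left_mono mult_nonneg_nonneg zero_less_one)
    then show ?thesis
      using dependent_nat_choice[of "\<lambda>n y. (n = 0 \<longrightarrow> y = x) \<and> 0 \<le> y \<and> y \<le> ?M"
        "\<lambda>n y y'. \<exists>d\<le>m. y' = q * y - real d"] assms(3,4)
      by (metis nat.distinct(1))
  qed
  then show ?thesis by metis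
qed

section \<open>Differences of digit sums, that is, sums with signed digits\<close>

lemma digit_diffs_append:
  assumes "a \<in> digit_diffs m q n" "b \<in> digit_diffs m q k"
  shows "a + q ^ n * b \<in> digit_diffs m q (n + k)"
proof -
  obtain a1 a2 b1 b2 where "a = a1 - a2" "b = b1 - b2" "a1 \<in> digit_sums m q n" "a2 \<in> digit_sums m q n"
    "b1 \<in> digit_sums m q k" "b2 \<in> digit_sums m q k"
    using assms unfolding digit_diffs_def by blast
  then show ?thesis unfolding digit_diffs_def
    by (intro CollectI exI[of _ "a1 + q ^ n * b1"] exI[of _ "a2 + q ^ n * b2"])
      (simp add: ring_distribs digit_sums_append)
qed

lemma digit_diffs_minus: "a \<in> digit_diffs m q n \<Longrightarrow> - a \<in> digit_diffs m q n"
  unfolding digit_diffs_def by (smt (verit) mem_Collect_eq minus_diff_eq)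

lemma digit_diffs_zero: "0 \<in> digit_diffs m q n"
  unfolding digit_diffs_def using digit_sums_zero by force

lemma digit_diffs_mono: "n \<le> k \<Longrightarrow> digit_diffs m q n \<subseteq> digit_diffs m q k"
  unfolding digit_diffs_def using digit_sums_mono by blast

lemma digit_diffs_le_digits: "m \<le> k \<Longrightarrow> digit_diffs m q n \<subseteq> digit_diffs k q n"
  unfolding digit_diffs_def using digit_sums_le_digits by blast

lemma digit_diffs_digit:
  assumes "\<bar>d\<bar> \<le> int m" shows "of_int d \<in> digit_diffs m q (Suc 0)"
proof -
  have "real (nat d) \<in> digit_sums m q (Suc 0)" "real (nat (- d)) \<in> digit_sums m q (Suc 0)"
    using assms by (intro digit_sums_single; linarith)+
  moreover have "(of_int d :: real) = real (nat d) - real (nat (- d))" by linarith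
  ultimately show ?thesis unfolding digit_diffs_def by blast
qed

lemma digit_diffs_shift:
  assumes "a \<in> digit_diffs m q n" "\<bar>d\<bar> \<le> int m"
  shows "q * a + of_int d \<in> digit_diffs m q (Suc n)"
  using digit_diffs_append[OF digit_diffs_digit[OF assms(2)] assms(1)] by (simp add: add.commute)

text \<open>Regrouping \<open>(a1 - a2) - (b1 - b2)\<close> as \<open>(a1 + b2) - (a2 + b1)\<close>
  doubles the digit bound, whence the digits up to \<open>2 * m\<close> in the theorem.\<close>

lemma digit_diffs_diff:
  assumes "a \<in> digit_diffs m q n" "b \<in> digit_diffs m q k"
  shows "a - b \<in> digit_diffs (2 * m) q (max n k)"
proof -
  have "a \<in> digit_diffs m q (max n k)" "b \<in> digit_diffs m q (max n k)"
    using assms digit_diffs_mono[of n "max n k"] digit_diffs_mono[of k "max n k"] by (blast intro: max.cobounded1 max.cobounded2)+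
  then obtain a1 a2 b1 b2 where "a = a1 - a2" "b = b1 - b2"
    "a1 \<in> digit_sums m q (max n k)" "a2 \<in> digit_sums m q (max n k)"
    "b1 \<in> digit_sums m q (max n k)" "b2 \<in> digit_sums m q (max n k)"
    unfolding digit_diffs_def by blast
  then show ?thesis unfolding digit_diffs_def mult_2
    by (intro CollectI exI[of _ "a1 + b2"] exI[of _ "a2 + b1"])
      (auto simp: algebra_simps intro: digit_sums_add)
qed

subsection \<open>Admissible periods\<close>

text \<open>These are the admissible periods of the overview. For \<open>y = a - b\<close> the
  number \<open>r\<close> is the error made when the digit sum \<open>a\<close>, translated by
  \<open>q ^ n * \<delta>\<close>, is replaced by the digit sum \<open>b\<close>.\<close>

definition finite_offsets :: "nat \<Rightarrow> real \<Rightarrow> real \<Rightarrow> bool" where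
  "finite_offsets m q \<delta> \<longleftrightarrow>
     (\<forall>C. finite {r. \<bar>r\<bar> \<le> C \<and> (\<exists>n. \<exists>y\<in>digit_diffs m q n. r = q ^ n * \<delta> + y)})"

lemma finite_offsets_digit_diffs:
  assumes fin: "\<And>C. finite {y \<in> (\<Union>n. digit_diffs m q n). \<bar>y\<bar> \<le> C}"
    and "\<delta> \<in> digit_diffs m q k"
  shows "finite_offsets m q \<delta>"
  unfolding finite_offsets_def
proof
  fix C
  have "{r. \<bar>r\<bar> \<le> C \<and> (\<exists>n. \<exists>y\<in>digit_diffs m q n. r = q ^ n * \<delta> + y)}
      \<subseteq> {y \<in> (\<Union>n. digit_diffs m q n). \<bar>y\<bar> \<le> C}"
    using digit_diffs_append[OF _ assms(2)] by (fastforce simp: add.commute)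
  then show "finite {r. \<bar>r\<bar> \<le> C \<and> (\<exists>n. \<exists>y\<in>digit_diffs m q n. r = q ^ n * \<delta> + y)}"
    using fin finite_subset by blast
qed

text \<open>This is the argument of the Fine--Wilf periodicity theorem: a translation by
  \<open>q ^ n * (\<delta>\<^sub>1 - \<delta>\<^sub>2)\<close> inside \<open>[0, q ^ n * m / (q - 1)]\<close> splits into the two translations, performed
  in the order that does not leave this interval.\<close>

lemma finite_offsets_diff:
  assumes q: "q > 1" "real m \<ge> q - 1"
    and P1: "finite_offsets m q \<delta>\<^sub>1" and P2: "finite_offsets m q \<delta>\<^sub>2"
    and pos: "0 \<le> \<delta>\<^sub>1" "0 \<le> \<delta>\<^sub>2" and le: "\<delta>\<^sub>1 + \<delta>\<^sub>2 \<le> real m / (q - 1)"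
  shows "finite_offsets m q (\<delta>\<^sub>1 - \<delta>\<^sub>2)"
  unfolding finite_offsets_def
proof
  fix C
  let ?M = "real m / (q - 1)"
  let ?R = "\<lambda>\<delta> C. {r. \<bar>r\<bar> \<le> C \<and> (\<exists>n. \<exists>y\<in>digit_diffs m q n. r = q ^ n * \<delta> + y)}"
  have "?R (\<delta>\<^sub>1 - \<delta>\<^sub>2) C \<subseteq> (\<lambda>(r, s). r - s) ` (?R \<delta>\<^sub>1 (C + ?M) \<times> ?R \<delta>\<^sub>2 (C + ?M))"
  proof
    fix r assume "r \<in> ?R (\<delta>\<^sub>1 - \<delta>\<^sub>2) C"
    then obtain n a b where r: "\<bar>r\<bar> \<le> C" "r = q ^ n * (\<delta>\<^sub>1 - \<delta>\<^sub>2) + (a - b)"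
      and ab: "a \<in> digit_sums m q n" "b \<in> digit_sums m q n"
      unfolding digit_diffs_def by blast
    have qn: "q ^ n > 0" using q by simp
    have a: "0 \<le> a" "a \<le> q ^ n * ?M" using digit_sums_bounds[OF q(1) ab(1)] by auto
    have M: "?M \<ge> 0" using q by simp
    \<comment> \<open>The digit sum \<open>w\<close> approximates the intermediate point on the way
      from \<open>a\<close> to \<open>b\<close>: either \<open>a + q ^ n * \<delta>\<^sub>1\<close>
      or \<open>a - q ^ n * \<delta>\<^sub>2\<close>.\<close>
    have "\<exists>w\<in>digit_sums m q n. \<bar>q ^ n * \<delta>\<^sub>1 + (a - w)\<bar> \<le> C + ?M \<and> \<bar>q ^ n * \<delta>\<^sub>2 + (b - w)\<bar> \<le> C + ?M
       \<or> \<bar>q ^ n * \<delta>\<^sub>1 + (w - b)\<bar> \<le> C + ?M \<and> \<bar>q ^ n * \<delta>\<^sub>2 + (w - a)\<bar> \<le> C + ?M"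
    proof (cases "a + q ^ n * \<delta>\<^sub>1 \<le> q ^ n * ?M")
      case True
      obtain w where w: "w \<in> digit_sums m q n" "0 \<le> a + q ^ n * \<delta>\<^sub>1 - w" "a + q ^ n * \<delta>\<^sub>1 - w \<le> ?M"
        using digit_approx[OF q _ True] a qn pos by fastforce
      moreover have "q ^ n * \<delta>\<^sub>2 + (b - w) = (a + q ^ n * \<delta>\<^sub>1 - w) - r"
        unfolding r by (simp add: algebra_simps)
      ultimately show ?thesis using r(1) by (intro bexI[of _ w]) auto
    next
      case False
      have "q ^ n * (\<delta>\<^sub>1 + \<delta>\<^sub>2) \<le> q ^ n * ?M" using le qn by (intro mult_left_mono) auto
      with False have "0 \<le> a - q ^ n * \<delta>\<^sub>2" by (simp add: ring_distribs)
      moreover have "a - q ^ n * \<delta>\<^sub>2 \<le> q ^ n * ?M" using a pos qn by (smt (verit) mult_nonneg_nonneg)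
      ultimately obtain w where w: "w \<in> digit_sums m q n" "0 \<le> a - q ^ n * \<delta>\<^sub>2 - w" "a - q ^ n * \<delta>\<^sub>2 - w \<le> ?M"
        using digit_approx[OF q] by blast
      moreover have "q ^ n * \<delta>\<^sub>1 + (w - b) = r - (a - q ^ n * \<delta>\<^sub>2 - w)"
        unfolding r by (simp add: algebra_simps)
      moreover have "q ^ n * \<delta>\<^sub>2 + (w - a) = - (a - q ^ n * \<delta>\<^sub>2 - w)" by simp
      ultimately show ?thesis using r(1) by (intro bexI[of _ w]) auto
    qed
    then obtain w where w: "w \<in> digit_sums m q n" and
      "\<bar>q ^ n * \<delta>\<^sub>1 + (a - w)\<bar> \<le> C + ?M \<and> \<bar>q ^ n * \<delta>\<^sub>2 + (b - w)\<bar> \<le> C + ?M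
       \<or> \<bar>q ^ n * \<delta>\<^sub>1 + (w - b)\<bar> \<le> C + ?M \<and> \<bar>q ^ n * \<delta>\<^sub>2 + (w - a)\<bar> \<le> C + ?M" by blast
    then show "r \<in> (\<lambda>(r, s). r - s) ` (?R \<delta>\<^sub>1 (C + ?M) \<times> ?R \<delta>\<^sub>2 (C + ?M))"
    proof (elim disjE conjE)
      assume "\<bar>q ^ n * \<delta>\<^sub>1 + (a - w)\<bar> \<le> C + ?M" "\<bar>q ^ n * \<delta>\<^sub>2 + (b - w)\<bar> \<le> C + ?M"
      moreover have "a - w \<in> digit_diffs m q n" "b - w \<in> digit_diffs m q n"
        using ab w unfolding digit_diffs_def by blast+
      ultimately have "(q ^ n * \<delta>\<^sub>1 + (a - w), q ^ n * \<delta>\<^sub>2 + (b - w)) \<in> ?R \<delta>\<^sub>1 (C + ?M) \<times> ?R \<delta>\<^sub>2 (C + ?M)"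
        by blast
      then show ?thesis unfolding r(2) by (rule rev_image_eqI) (simp add: algebra_simps)
    next
      assume "\<bar>q ^ n * \<delta>\<^sub>1 + (w - b)\<bar> \<le> C + ?M" "\<bar>q ^ n * \<delta>\<^sub>2 + (w - a)\<bar> \<le> C + ?M"
      moreover have "w - b \<in> digit_diffs m q n" "w - a \<in> digit_diffs m q n"
        using ab w unfolding digit_diffs_def by blast+
      ultimately have "(q ^ n * \<delta>\<^sub>1 + (w - b), q ^ n * \<delta>\<^sub>2 + (w - a)) \<in> ?R \<delta>\<^sub>1 (C + ?M) \<times> ?R \<delta>\<^sub>2 (C + ?M)"
        by blast
      then show ?thesis unfolding r(2) by (rule rev_image_eqI) (simp add: algebra_simps)
    qed
  qed
  then show "finite (?R (\<delta>\<^sub>1 - \<delta>\<^sub>2) C)"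
    using P1 P2 unfolding finite_offsets_def by (meson finite_SigmaI finite_imageI finite_subset)
qed

text \<open>Subtractive Euclid starting from \<open>t\<close> and \<open>1 - t\<close>: the
  irrational ratio keeps the two numbers distinct, and their sum only decreases from 1. If no
  positive element were below \<open>\<epsilon>\<close>, each step would lower the sum by at least
  \<open>\<epsilon>\<close>; \<open>n\<close> bounds the number of steps.\<close>

lemma euclid_small:
  fixes A :: "real set"
  assumes A: "\<And>a b. a \<in> A \<Longrightarrow> b \<in> A \<Longrightarrow> 0 < b \<Longrightarrow> b < a \<Longrightarrow> a + b \<le> 1 \<Longrightarrow> a - b \<in> A"
    and t: "t \<in> A" "1 - t \<in> A" "0 < t" "t < 1" "t \<notin> \<rat>" and \<epsilon>: "\<epsilon> > 0"
  shows "\<exists>\<delta>\<in>A. 0 < \<delta> \<and> \<delta> < \<epsilon>"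
proof (rule ccontr)
  assume "\<not> ?thesis"
  then have big: "\<epsilon> \<le> a" if "a \<in> A" "0 < a" for a using that by force
  have False if "a \<in> A" "b \<in> A" "0 < a" "0 < b" "a + b \<le> 1" "a / b \<notin> \<rat>" "a + b \<le> real n * \<epsilon>" for a b n
    using that
  proof (induction n arbitrary: a b)
    case 0
    then show ?case by simp
  next
    case (Suc n)
    have "a \<noteq> b" using Suc.prems by auto
    then consider "b < a" | "a < b" by linarith
    then show ?case
    proof cases
      case 1
      have "(a - b) / b = a / b - 1" using Suc.prems by (simp add: field_simps)
      then have "(a - b) / b \<notin> \<rat>" using Suc.prems Rats_add[of "a / b - 1" 1] by auto
      then show ?thesis
        using Suc.IH[of "a - b" b] Suc.prems 1 A[of a b] big[of b] by (auto simp: algebra_simps)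
    next
      case 2
      have "b / a \<notin> \<rat>" using Suc.prems Rats_inverse[of "b / a"] by auto
      moreover have "(b - a) / a = b / a - 1" using Suc.prems by (simp add: field_simps)
      ultimately have "(b - a) / a \<notin> \<rat>" using Rats_add[of "b / a - 1" 1] by auto
      then show ?thesis
        using Suc.IH[of "b - a" a] Suc.prems 2 A[of b a] big[of a] by (auto simp: algebra_simps)
    qed
  qed
  moreover obtain n where "t + (1 - t) \<le> real n * \<epsilon>"
    using reals_Archimedean3[OF \<epsilon>] by (metis less_imp_le)
  moreover have "(1 - t) / t \<notin> \<rat>"
  proof
    assume "(1 - t) / t \<in> \<rat>"
    then have "inverse ((1 - t) / t + 1) \<in> \<rat>" by (intro Rats_inverse Rats_add) auto
    moreover have "inverse ((1 - t) / t + 1) = t" using t by (simp add: field_simps)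
    ultimately show False using t by simp
  qed
  ultimately show False using t by (metis add.commute diff_add_cancel diff_gt_0_iff_gt order_refl)
qed

subsection \<open>Conjugation as a homomorphism\<close>

text \<open>The model is the ring of rational polynomials in \<open>q\<close> with the homomorphism
  sending \<open>q\<close> to \<open>p\<close>. Only the additive structure, multiplication by
  \<open>q\<close> and injectivity are recorded.\<close>

locale conjugation =
  fixes q :: real and p :: complex and G :: "real set" and \<kappa> :: "real \<Rightarrow> complex"
  assumes of_rat_mem: "\<And>r. of_rat r \<in> G"
    and diff_mem: "\<And>x y. x \<in> G \<Longrightarrow> y \<in> G \<Longrightarrow> x - y \<in> G"
    and mult_mem: "\<And>x. x \<in> G \<Longrightarrow> q * x \<in> G"
    and conj_of_rat: "\<And>r. \<kappa> (of_rat r) = of_rat r"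
    and conj_diff: "\<And>x y. x \<in> G \<Longrightarrow> y \<in> G \<Longrightarrow> \<kappa> (x - y) = \<kappa> x - \<kappa> y"
    and conj_mult: "\<And>x. x \<in> G \<Longrightarrow> \<kappa> (q * x) = p * \<kappa> x"
    and conj_eq_0: "\<And>x. x \<in> G \<Longrightarrow> \<kappa> x = 0 \<Longrightarrow> x = 0"
begin

lemma of_int_mem: "of_int k \<in> G"
  using of_rat_mem[of "of_int k"] by simp

lemma conj_of_int: "\<kappa> (of_int k) = of_int k"
  using conj_of_rat[of "of_int k"] by simp

lemma one_mem: "1 \<in> G" and conj_one: "\<kappa> 1 = 1"
  using of_int_mem[of 1] conj_of_int[of 1] by simp_all

lemma power_mem: "q ^ n \<in> G" and conj_power: "\<kappa> (q ^ n) = p ^ n"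
proof -
  have "q ^ n \<in> G \<and> \<kappa> (q ^ n) = p ^ n"
    by (induction n) (auto simp: one_mem conj_one mult_mem conj_mult)
  then show "q ^ n \<in> G" "\<kappa> (q ^ n) = p ^ n" by auto
qed

text \<open>Injectivity of \<open>\<kappa>\<close> would carry the relation over to
  \<open>q ^ k = 1\<close>.\<close>

lemma root_of_unity:
  assumes "q > 1" "p ^ k = 1" shows "k = 0"
proof (rule ccontr)
  assume "k \<noteq> 0"
  have "\<kappa> (q ^ k - 1) = 0" by (simp add: conj_diff power_mem one_mem conj_power conj_one assms)
  then have "q ^ k - 1 = 0" by (intro conj_eq_0 diff_mem power_mem one_mem)
  then show False using assms \<open>k \<noteq> 0\<close> one_less_power[of q k] by simp
qed

lemma remainder_mem:
  fixes d :: "nat \<Rightarrow> int"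
  assumes "z 0 \<in> G" "\<And>n. z (Suc n) = q * z n - of_int (d n)"
  shows "z n \<in> G"
  by (induction n) (auto simp: assms mult_mem diff_mem of_int_mem)

lemma conj_remainder:
  fixes d :: "nat \<Rightarrow> int"
  assumes "z 0 \<in> G" "\<And>n. z (Suc n) = q * z n - of_int (d n)"
  shows "\<kappa> (z (Suc n)) = p * \<kappa> (z n) - of_int (d n)"
  using remainder_mem[of z d, OF assms] by (simp add: assms(2) conj_diff conj_mult mult_mem of_int_mem conj_of_int)

text \<open>The digits cancel in the difference of the two recursions. What remains is a linear
  recursion driven by \<open>(p - q) * z n\<close>, whose solution has the remainders themselves as
  coefficients.\<close>

lemma conj_remainder_minus:
  fixes d :: "nat \<Rightarrow> int"
  assumes "z 0 = 1" "\<And>n. z (Suc n) = q * z n - of_int (d n)"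
  shows "\<kappa> (z n) - of_real (z n) = (p - of_real q) * (\<Sum>j<n. of_real (z j) * p ^ (n - Suc j))"
proof (induction n)
  case 0
  then show ?case by (simp add: assms conj_one)
next
  case (Suc n)
  have "z 0 \<in> G" by (simp add: assms one_mem)
  then have "\<kappa> (z (Suc n)) - of_real (z (Suc n)) = p * (\<kappa> (z n) - of_real (z n)) + (p - of_real q) * of_real (z n)"
    using conj_remainder[of z d n, OF _ assms(2)] by (simp add: assms(2)[of n] algebra_simps)
  also have "\<dots> = (p - of_real q) * (p * (\<Sum>j<n. of_real (z j) * p ^ (n - Suc j)) + of_real (z n))"
    unfolding Suc by (simp add: algebra_simps)
  also have "p * (\<Sum>j<n. of_real (z j) * p ^ (n - Suc j)) = (\<Sum>j<n. of_real (z j) * p ^ (Suc n - Suc j))"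
    unfolding sum_distrib_left by (intro sum.cong) (auto simp: Suc_diff_Suc simp flip: power_Suc)
  finally show ?case by simp
qed

end

section \<open>Existence of the conjugation\<close>

lemma map_poly_of_rat_diff:
  "map_poly of_rat (f - g) = (map_poly of_rat f - map_poly of_rat g :: 'a::field_char_0 poly)"
  by (intro poly_eqI) (simp add: coeff_map_poly of_rat_diff)

lemma map_poly_of_rat_add:
  "map_poly of_rat (f + g) = (map_poly of_rat f + map_poly of_rat g :: 'a::field_char_0 poly)"
  by (intro poly_eqI) (simp add: coeff_map_poly of_rat_add)

lemma map_poly_of_rat_mult:
  "map_poly of_rat (f * g) = (map_poly of_rat f * map_poly of_rat g :: 'a::field_char_0 poly)"
  by (intro poly_eqI) (simp add: coeff_map_poly coeff_mult of_rat_sum of_rat_mult)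

lemma irreducible_root_dvd:
  fixes x :: "'a :: field_char_0"
  assumes "irreducible f" "poly (map_poly of_rat f) x = 0" "poly (map_poly of_rat g) x = 0"
  shows "f dvd g"
proof (rule ccontr)
  assume "\<not> f dvd g"
  then have "coprime f g"
    using assms(1) by (meson field_poly_irreducible_imp_prime prime_elem_imp_coprime)
  then obtain u v where "u * f + v * g = 1"
    using bezout_coefficients_fst_snd[of f g] by (metis coprime_imp_gcd_eq_1)
  then have "poly (map_poly of_rat (u * f + v * g)) x = 1" by simp
  then show False using assms by (simp add: map_poly_of_rat_add map_poly_of_rat_mult)
qed

lemma conjugate_root:
  assumes "algebraic_conjugate x z"
  shows "poly (map_poly of_rat g) x = 0 \<longleftrightarrow> poly (map_poly of_rat g) z = 0"
proof -
  obtain f :: "rat poly" where f: "irreducible f" "poly (map_poly of_rat f) x = 0" "poly (map_poly of_rat f) z = 0"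
    using assms unfolding algebraic_conjugate_def by blast
  then show ?thesis
    using irreducible_root_dvd[OF f(1,2), of g] irreducible_root_dvd[OF f(1,3), of g]
    by (metis dvdE map_poly_of_rat_mult mult_zero_left poly_mult)
qed

lemma poly_of_rat_of_real:
  "poly (map_poly of_rat g) (of_real x :: complex) = of_real (poly (map_poly of_rat g) x)"
proof -
  have "(of_rat r :: complex) = of_real (of_rat r)" for r
    by (cases r) (simp add: of_rat_rat)
  then show ?thesis by (induction g) (auto simp: map_poly_pCons)
qed

text \<open>The value of a rational polynomial at \<open>q\<close> is sent to its value at
  \<open>p\<close>. The choice of polynomial does not matter, because conjugates are roots of the
  same rational polynomials.\<close>

lemma conjugation_exists:
  assumes "algebraic_conjugate (of_real q) p"
  obtains G \<kappa> where "conjugation q p G \<kappa>"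
proof -
  define ev where "ev g = poly (map_poly of_rat g) q" for g :: "rat poly"
  define ev' where "ev' g = poly (map_poly of_rat g) p" for g :: "rat poly"
  define \<kappa> where "\<kappa> x = ev' (SOME g. ev g = x)" for x
  have zero: "ev g = 0 \<longleftrightarrow> ev' g = 0" for g
    using conjugate_root[OF assms, of g] by (simp add: ev_def ev'_def poly_of_rat_of_real)
  have diff: "ev (f - g) = ev f - ev g" "ev' (f - g) = ev' f - ev' g" for f g
    by (simp_all add: ev_def ev'_def map_poly_of_rat_diff)
  have \<kappa>: "\<kappa> (ev g) = ev' g" for g
  proof -
    have "ev (SOME f. ev f = ev g) = ev g" by (rule someI) simp
    then have "ev ((SOME f. ev f = ev g) - g) = 0" by (simp add: diff)
    then show ?thesis unfolding \<kappa>_def using zero diff(2) by fastforce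
  qed
  have rat: "of_rat r = ev [:r:]" "of_rat r = ev' [:r:]" for r by (simp_all add: ev_def ev'_def map_poly_pCons)
  have mult: "q * ev g = ev (pCons 0 g)" "p * ev' g = ev' (pCons 0 g)" for g
    by (simp_all add: ev_def ev'_def map_poly_pCons)
  have "conjugation q p (range ev) \<kappa>"
  proof
    show "of_rat r \<in> range ev" for r by (simp add: rat(1))
    show "\<kappa> (of_rat r) = of_rat r" for r unfolding rat(1) \<kappa> by (simp add: rat(2))
  next
    fix x assume "x \<in> range ev"
    then obtain g where g: "x = ev g" by blast
    show "q * x \<in> range ev" "\<kappa> (q * x) = p * \<kappa> x" by (simp_all add: g mult \<kappa>)
    show "x = 0" if "\<kappa> x = 0" using that by (simp add: g \<kappa> zero)
    fix y assume "y \<in> range ev"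
    then obtain h where h: "y = ev h" by blast
    show "x - y \<in> range ev" "\<kappa> (x - y) = \<kappa> x - \<kappa> y" by (simp_all add: g h \<kappa> flip: diff)
  qed
  then show thesis by (rule that)
qed

subsection \<open>Sign-aligned expansions\<close>

text \<open>Take \<open>a = (1 + \<i> * \<tau>) / \<omega>\<close>. The sign condition on
  \<open>\<omega> ^ 2\<close> leaves an uncountable set \<open>T\<close> of real \<tau>, since
  \<omega> is not positive real, while each power of \<omega> excludes at most one value of
  \<tau>.\<close>

lemma generic_direction:
  fixes \<omega> :: complex
  assumes "\<omega> \<noteq> 0" "\<not> (Im \<omega> = 0 \<and> Re \<omega> > 0)"
  shows "\<exists>a. Re (a * \<omega>) > 0 \<and> Re (a * \<omega> ^ 2) < 0 \<and> (\<forall>i. Re (a * \<omega> ^ Suc i) \<noteq> 0)"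
proof -
  define T where "T = {\<tau>. Re \<omega> < \<tau> * Im \<omega>}"
  have "uncountable T"
  proof -
    consider "Im \<omega> = 0" "Re \<omega> < 0" | "Im \<omega> > 0" | "Im \<omega> < 0"
      using assms by (metis complex_eq_iff linorder_neqE_linordered_idom zero_complex.simps)
    then have "\<exists>x y. x < y \<and> {x<..<y} \<subseteq> T"
    proof cases
      case 1
      then show ?thesis by (intro exI[of _ 0] exI[of _ 1]) (auto simp: T_def)
    next
      case 2
      then show ?thesis
        by (intro exI[of _ "Re \<omega> / Im \<omega>"] exI[of _ "Re \<omega> / Im \<omega> + 1"]) (auto simp: T_def field_simps)
    next
      case 3
      then show ?thesis
        by (intro exI[of _ "Re \<omega> / Im \<omega> - 1"] exI[of _ "Re \<omega> / Im \<omega>"]) (auto simp: T_def field_simps)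
    qed
    then show ?thesis using uncountable_open_interval countable_subset by metis
  qed
  moreover have "countable (range (\<lambda>i. Re (\<omega> ^ i) / Im (\<omega> ^ i)))" by simp
  ultimately obtain \<tau> where \<tau>: "\<tau> \<in> T" "\<tau> \<notin> range (\<lambda>i. Re (\<omega> ^ i) / Im (\<omega> ^ i))"
    by (meson countable_subset subsetI)
  define a where "a = Complex 1 \<tau> / \<omega>"
  have a: "a * \<omega> ^ Suc i = Complex 1 \<tau> * \<omega> ^ i" for i using assms by (simp add: a_def)
  have "Re (a * \<omega> ^ Suc i) \<noteq> 0" for i
  proof
    assume "Re (a * \<omega> ^ Suc i) = 0"
    then have *: "Re (\<omega> ^ i) = \<tau> * Im (\<omega> ^ i)" unfolding a by simp
    moreover have "\<omega> ^ i \<noteq> 0" using assms by simp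
    ultimately have "Im (\<omega> ^ i) \<noteq> 0" by (metis complex_eqI mult_zero_right zero_complex.simps)
    with * have "\<tau> = Re (\<omega> ^ i) / Im (\<omega> ^ i)" by simp
    with \<tau>(2) show False by blast
  qed
  moreover have "Re (a * \<omega>) > 0" using a[of 0] by simp
  moreover have "a * \<omega> ^ 2 = Complex 1 \<tau> * \<omega>" using a[of 1] by (simp add: numeral_2_eq_2)
  then have "Re (a * \<omega> ^ 2) < 0" using \<tau>(1) by (simp add: T_def)
  ultimately show ?thesis by blast
qed

text \<open>\<open>N\<close> marks the positions where digits must be nonpositive. Let
  \<open>a 0\<close> be the number with digit \<open>m\<close> exactly at these positions; expanding
  \<open>a 0 + \<delta>\<close> with digits \<open>0..m\<close> and subtracting the digits of
  \<open>a 0\<close> yields the required signs.\<close>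

lemma signed_expansion:
  fixes N :: "nat \<Rightarrow> bool"
  assumes q: "q > 1" "real m \<ge> q - 1" and \<delta>: "0 \<le> \<delta>" "\<delta> \<le> real m / q ^ 2" and N: "\<not> N 0 \<or> \<not> N 1"
  shows "\<exists>(\<rho> :: nat \<Rightarrow> real) (d :: nat \<Rightarrow> int). \<rho> 0 = \<delta> \<and> (\<forall>n. \<rho> (Suc n) = q * \<rho> n - of_int (d n) \<and>
    \<bar>\<rho> n\<bar> \<le> real m / (q - 1) \<and> \<bar>d n\<bar> \<le> int m \<and> (if N n then d n \<le> 0 else 0 \<le> d n))"
proof -
  let ?M = "real m / (q - 1)"
  define w where "w n = (if N n then real m else 0)" for n
  define a where "a n = (\<Sum>j. w (n + j) / q ^ Suc j)" for n
  have full: "(\<lambda>j. real m / q ^ Suc j) sums ?M"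
  proof -
    have s: "(\<lambda>j. real m / q * (1 / q) ^ j) sums (real m / q * (1 / (1 - 1 / q)))"
      using q by (intro sums_mult geometric_sums) auto
    have "q * (1 - 1 / q) = q - 1" using q by (simp add: field_simps)
    then have "real m / q * (1 / (1 - 1 / q)) = ?M" by (metis mult.right_neutral times_divide_times_eq)
    moreover have "(\<lambda>j. real m / q * (1 / q) ^ j) = (\<lambda>j. real m / q ^ Suc j)"
      by (simp add: power_divide)
    ultimately show ?thesis using s by (simp only:)
  qed
  have summ: "summable (\<lambda>j. w (n + j) / q ^ Suc j)" for n
    using q by (intro summable_comparison_test'[OF sums_summable[OF full], of 0])
      (auto simp: w_def field_simps)
  have a0: "0 \<le> a n" for n
    unfolding a_def using q by (intro suminf_nonneg summ) (auto simp: w_def)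
  have aM: "a n \<le> ?M" for n
    unfolding a_def sums_unique[OF full] using q
    by (intro suminf_le summ sums_summable[OF full]) (auto simp: w_def divide_right_mono)
  have aS: "a (Suc n) = q * a n - w n" for n
  proof -
    have "a n = w n / q + (\<Sum>j. w (n + Suc j) / q ^ Suc (Suc j))"
      unfolding a_def using suminf_split_head[OF summ[of n]] by simp
    also have "(\<Sum>j. w (n + Suc j) / q ^ Suc (Suc j)) = (\<Sum>j. inverse q * (w (Suc n + j) / q ^ Suc j))"
      using q by (intro suminf_cong) (simp add: field_simps)
    also have "\<dots> = inverse q * a (Suc n)" unfolding a_def by (intro suminf_mult summ)
    finally show ?thesis using q by (simp add: field_simps)
  qed
  have a0_le: "a 0 + real m / q ^ 2 \<le> ?M"
  proof -
    \<comment> \<open>One of the first two positions is unmarked; its weight, at least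
      \<open>m / q ^ 2\<close>, is the room left for \<open>\<delta>\<close>.\<close>
    define k :: nat where "k = (if N 0 then 1 else 0)"
    have k: "\<not> N k" "k \<le> 1" using N by (auto simp: k_def)
    have "(\<lambda>j. real m / q ^ Suc j - w (0 + j) / q ^ Suc j) sums (?M - a 0)"
      unfolding a_def by (intro sums_diff full summable_sums summ)
    then have s: "(\<lambda>j. (real m - w j) / q ^ Suc j) sums (?M - a 0)" by (simp add: diff_divide_distrib)
    have "sum (\<lambda>j. (real m - w j) / q ^ Suc j) {k} \<le> ?M - a 0"
      using s q unfolding sums_unique[OF s]
      by (intro sum_le_suminf sums_summable[OF s]) (auto simp: w_def)
    then have "real m / q ^ Suc k \<le> ?M - a 0" using k by (simp add: w_def)
    moreover have "real m / q ^ 2 \<le> real m / q ^ Suc k"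
      using q k by (intro divide_left_mono power_increasing) auto
    ultimately show ?thesis by simp
  qed
  obtain z e where z: "z 0 = a 0 + \<delta>"
    "\<And>n. z (Suc n) = q * z n - real (e n) \<and> e n \<le> m \<and> 0 \<le> z n \<and> z n \<le> ?M"
  proof -
    have "0 \<le> a 0 + \<delta>" "a 0 + \<delta> \<le> ?M" using a0[of 0] \<delta> a0_le by linarith+
    from digit_expansion[OF q this] show thesis using that by blast
  qed
  define d where "d n = int (e n) - (if N n then int m else 0)" for n
  have "z (Suc n) - a (Suc n) = q * (z n - a n) - of_int (d n)" for n
    using z(2)[of n] by (simp add: aS d_def w_def algebra_simps)
  moreover have "\<bar>z n - a n\<bar> \<le> ?M" for n using z(2)[of n] a0[of n] aM[of n] by linarith
  moreover have "\<bar>d n\<bar> \<le> int m" "if N n then d n \<le> 0 else 0 \<le> d n" for n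
    using z(2)[of n] by (auto simp: d_def)
  ultimately show ?thesis
    using z(1) by (intro exI[of _ "\<lambda>n. z n - a n"] exI[of _ d]) simp
qed

text \<open>Multiplication by \<open>1 - \<omega>\<close> writes \<open>z 0\<close> as a combination
  of real parts of powers of \<omega>, with nonnegative weights of total \<open>z 0\<close>. Every
  real part is at most 1, and the positive weight \<open>z 0 - z 1\<close> forces
  \<open>Re \<omega> = 1\<close>.\<close>

lemma enestrom_kakeya:
  fixes \<omega> :: complex and z :: "nat \<Rightarrow> real"
  assumes \<omega>: "cmod \<omega> \<le> 1" "\<omega> \<noteq> 1" and z: "0 < z 0" "z 1 < z 0" "0 \<le> z n" "\<And>j. j < n \<Longrightarrow> z (Suc j) \<le> z j"
    and root: "(\<Sum>j\<le>n. of_real (z j) * \<omega> ^ j) = 0"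
  shows False
proof -
  have n: "n > 0" using root z by (cases n) auto
  have id: "(1 - \<omega>) * (\<Sum>j\<le>k. of_real (z j) * \<omega> ^ j)
      = of_real (z 0) - (\<Sum>j<k. of_real (z j - z (Suc j)) * \<omega> ^ Suc j) - of_real (z k) * \<omega> ^ Suc k" for k
    by (induction k) (simp_all add: algebra_simps)
  have re: "Re (\<omega> ^ Suc j) \<le> 1" for j
    using complex_Re_le_cmod[of "\<omega> ^ Suc j"] power_le_one[OF norm_ge_zero \<omega>(1), of "Suc j"]
    by (simp add: norm_power norm_mult)
  have "z 0 = (\<Sum>j<n. (z j - z (Suc j)) * Re (\<omega> ^ Suc j)) + z n * Re (\<omega> ^ Suc n)"
    using arg_cong[OF id[of n], of Re] unfolding root by (simp del: power_Suc of_real_diff)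
  also have "\<dots> \<le> (\<Sum>j<n. (z j - z (Suc j)) * (if j = 0 then Re \<omega> else 1)) + z n * 1"
    using re z by (intro add_mono sum_mono mult_left_mono) (auto simp del: power_Suc)
  also have "(\<Sum>j<n. (z j - z (Suc j)) * (if j = 0 then Re \<omega> else 1))
      = (\<Sum>j<n. z j - z (Suc j)) + (\<Sum>j<n. if j = 0 then (z 0 - z 1) * (Re \<omega> - 1) else 0)"
    unfolding sum.distrib[symmetric] by (intro sum.cong) (auto simp: algebra_simps)
  also have "\<dots> = z 0 - z n + (z 0 - z 1) * (Re \<omega> - 1)"
    using n by (simp add: sum_lessThan_telescope' sum.delta)
  finally have "0 \<le> (z 0 - z 1) * (Re \<omega> - 1)" by simp
  then have "Re \<omega> \<ge> 1" using z by (simp add: zero_le_mult_iff)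
  moreover have "(Re \<omega>)\<^sup>2 + (Im \<omega>)\<^sup>2 \<le> 1"
    using \<omega>(1) by (simp add: cmod_def)
  moreover have "(Re \<omega>)\<^sup>2 \<ge> Re \<omega>" using \<open>Re \<omega> \<ge> 1\<close> by (simp add: power2_eq_square)
  ultimately have "Re \<omega> = 1" "Im \<omega> = 0" by (smt (verit) zero_le_power2 power2_eq_iff one_power2 zero_eq_power2)+
  then show False using \<omega>(2) by (simp add: complex_eq_iff)
qed

context conjugation
begin

lemma aligned_contradiction:
  assumes q: "q > 1" "real m \<ge> q - 1" "m > 0"
    and p: "cmod p \<ge> 1" "\<not> (Im p = 0 \<and> Re p > 0)"
    and small: "\<And>\<epsilon>. \<epsilon> > 0 \<Longrightarrow> \<exists>\<delta>\<in>G. finite_offsets m q \<delta> \<and> 0 < \<delta> \<and> \<delta> < \<epsilon>"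
  shows False
proof -
  define \<omega> where "\<omega> = inverse p"
  have p0: "p \<noteq> 0" using p by auto
  have \<omega>: "\<omega> \<noteq> 0" "cmod \<omega> \<le> 1" "p * \<omega> = 1" using p p0
    by (auto simp: \<omega>_def norm_inverse inverse_le_1_iff)
  have "\<not> (Im \<omega> = 0 \<and> Re \<omega> > 0)"
    using p by (auto simp: \<omega>_def complex_inverse zero_less_divide_iff)
  then obtain a where a: "Re (a * \<omega>) > 0" "Re (a * \<omega> ^ 2) < 0" "\<And>i. Re (a * \<omega> ^ Suc i) \<noteq> 0"
    using generic_direction \<omega>(1) by metis
  define c where "c i = Re (a * \<omega> ^ Suc i)" for i
  have c: "c 0 > 0" "c 1 < 0" "\<And>i. c i \<noteq> 0"
    using a by (auto simp: c_def numeral_2_eq_2)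
  let ?M = "real m / (q - 1)"
  have "real m / q ^ 2 > 0" using q by simp
  then obtain \<delta> where \<delta>: "\<delta> \<in> G" "finite_offsets m q \<delta>" "0 < \<delta>" "\<delta> < real m / q ^ 2"
    using small by blast
  \<comment> \<open>With these signs every \<open>d i * c i\<close> has the sign opposite to
    \<open>Re (a * \<kappa> \<delta>)\<close>, so nothing cancels in the conjugate
    expansion.\<close>
  define N where "N i \<longleftrightarrow> (if Re (a * \<kappa> \<delta>) \<ge> 0 then c i > 0 else c i < 0)" for i
  have "\<not> N 0 \<or> \<not> N 1" using c by (auto simp: N_def)
  then obtain \<rho> :: "nat \<Rightarrow> real" and d :: "nat \<Rightarrow> int" where
    \<rho>: "\<rho> 0 = \<delta>" "\<And>n. \<rho> (Suc n) = q * \<rho> n - of_int (d n)" "\<And>n. \<bar>\<rho> n\<bar> \<le> ?M"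
    and d: "\<And>n. \<bar>d n\<bar> \<le> int m" "\<And>n. if N n then d n \<le> 0 else 0 \<le> d n"
    using signed_expansion[OF q(1,2), of \<delta> N] \<delta> by (auto simp: less_imp_le)
  \<comment> \<open>This places all remainders in one finite set, so their conjugates are bounded
    too.\<close>
  have offset: "\<exists>y\<in>digit_diffs m q n. \<rho> n = q ^ n * \<delta> + y" for n
  proof (induction n)
    case 0
    then show ?case using \<rho>(1) digit_diffs_zero[of m q 0] by force
  next
    case (Suc n)
    then obtain y where y: "y \<in> digit_diffs m q n" "\<rho> n = q ^ n * \<delta> + y" by blast
    have "q * y + of_int (- d n) \<in> digit_diffs m q (Suc n)"
      by (intro digit_diffs_shift y) (use d in auto)
    then show ?case by (rule rev_bexI) (simp add: \<rho>(2) y algebra_simps)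
  qed
  define R where "R = {r. \<bar>r\<bar> \<le> ?M \<and> (\<exists>n. \<exists>y\<in>digit_diffs m q n. r = q ^ n * \<delta> + y)}"
  have R: "finite R" "\<And>n. \<rho> n \<in> R"
    using \<delta>(2) \<rho>(3) offset unfolding R_def finite_offsets_def by blast+
  obtain B where B: "\<And>n. cmod (\<kappa> (\<rho> n)) \<le> B"
  proof -
    have "finite ((\<lambda>r. cmod (\<kappa> r)) ` R)" using R by simp
    then obtain B where "\<And>r. r \<in> R \<Longrightarrow> cmod (\<kappa> r) \<le> B" using Max_ge by blast
    then show ?thesis using that R by blast
  qed
  have conj: "\<omega> ^ n * \<kappa> (\<rho> n) = \<kappa> \<delta> - (\<Sum>i<n. of_int (d i) * \<omega> ^ Suc i)" for n
  proof (induction n)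
    case (Suc n)
    have "\<kappa> (\<rho> (Suc n)) = p * \<kappa> (\<rho> n) - of_int (d n)"
      using conj_remainder[of \<rho> d] \<rho> \<delta> by simp
    then have "\<omega> ^ Suc n * \<kappa> (\<rho> (Suc n)) = \<omega> ^ Suc n * (p * \<kappa> (\<rho> n) - of_int (d n))"
      by (simp only:)
    also have "\<dots> = (p * \<omega>) * (\<omega> ^ n * \<kappa> (\<rho> n)) - of_int (d n) * \<omega> ^ Suc n"
      by (simp add: algebra_simps)
    finally have "\<omega> ^ Suc n * \<kappa> (\<rho> (Suc n)) = (p * \<omega>) * (\<omega> ^ n * \<kappa> (\<rho> n)) - of_int (d n) * \<omega> ^ Suc n" .
    then show ?case using Suc \<omega> by simp
  qed (simp add: \<rho>)
  define S where "S n = (\<Sum>i<n. \<bar>of_int (d i) * c i\<bar>)" for n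
  have S: "S n \<le> cmod a * cmod \<omega> ^ n * cmod (\<kappa> (\<rho> n))" for n
  proof -
    have "Re (a * (\<omega> ^ n * \<kappa> (\<rho> n))) = Re (a * \<kappa> \<delta>) - (\<Sum>i<n. of_int (d i) * c i)"
    proof -
      have "a * (\<omega> ^ n * \<kappa> (\<rho> n)) = a * \<kappa> \<delta> - (\<Sum>i<n. of_int (d i) * (a * \<omega> ^ Suc i))"
        unfolding conj by (simp add: right_diff_distrib sum_distrib_left mult_ac)
      then show ?thesis by (simp add: c_def del: power_Suc)
    qed
    moreover have "S n \<le> \<bar>Re (a * \<kappa> \<delta>) - (\<Sum>i<n. of_int (d i) * c i)\<bar>"
    proof (cases "Re (a * \<kappa> \<delta>) \<ge> 0")
      case True
      have "\<bar>of_int (d i) * c i\<bar> = - (of_int (d i) * c i)" for i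
        using d(2)[of i] True c(3)[of i] by (auto simp: N_def abs_if mult_less_0_iff zero_less_mult_iff split: if_splits)
      then have "S n = - (\<Sum>i<n. of_int (d i) * c i)" by (simp add: S_def sum_negf)
      then show ?thesis using True by linarith
    next
      case False
      have "\<bar>of_int (d i) * c i\<bar> = of_int (d i) * c i" for i
        using d(2)[of i] False c(3)[of i] by (auto simp: N_def abs_if mult_less_0_iff split: if_splits)
      then have "S n = (\<Sum>i<n. of_int (d i) * c i)" by (simp add: S_def)
      then show ?thesis using False by linarith
    qed
    ultimately have "S n \<le> \<bar>Re (a * (\<omega> ^ n * \<kappa> (\<rho> n)))\<bar>" by (simp only:)
    then have "S n \<le> cmod (a * (\<omega> ^ n * \<kappa> (\<rho> n)))" by (rule order_trans[OF _ abs_Re_le_cmod])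
    then show ?thesis by (simp add: norm_mult norm_power mult.assoc)
  qed
  have S0: "S n \<ge> 0" for n unfolding S_def by (intro sum_nonneg) auto
  have d_zero: "\<rho> k = q ^ k * \<delta>" if "S n = 0" "k \<le> n" for n k
    using that(2)
  proof (induction k)
    case (Suc k)
    have "\<bar>of_int (d k) * c k\<bar> = 0"
      using \<open>S n = 0\<close> Suc.prems unfolding S_def by (subst (asm) sum_nonneg_eq_0_iff) auto
    then show ?case using Suc c(3)[of k] by (simp add: \<rho>(2))
  qed (simp add: \<rho>)
  \<comment> \<open>A vanishing remainder would make \<open>S n\<close> vanish, hence all digits
    before \<open>n\<close>; but then the remainder is \<open>q ^ n * \<delta>\<close>.\<close>
  have nz: "\<rho> n \<noteq> 0" for n
  proof
    assume "\<rho> n = 0"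
    moreover have "\<kappa> 0 = 0" using conj_of_int[of 0] by simp
    ultimately have "S n = 0" using S[of n] S0[of n] by simp
    then show False using d_zero[of n n] \<open>\<rho> n = 0\<close> q \<delta>(3) by simp
  qed
  have escape: "\<exists>L. q ^ L * r > ?M" if "r > 0" for r
    using real_arch_pow[OF q(1), of "?M / r"] unfolding pos_divide_less_eq[OF that] .
  show False
  proof (cases "cmod \<omega> = 1")
    case False
    then have w: "cmod \<omega> < 1" using \<omega> by simp
    have "(\<lambda>n. cmod a * cmod \<omega> ^ n * B) \<longlonglongrightarrow> cmod a * 0 * B"
      using w by (intro tendsto_intros LIMSEQ_realpow_zero) auto
    moreover have "S k \<le> cmod a * cmod \<omega> ^ n * B" if "n \<ge> k" for k n
    proof -
      have "S k \<le> S n" unfolding S_def using that by (intro sum_mono2) auto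
      also note S[of n]
      also have "cmod a * cmod \<omega> ^ n * cmod (\<kappa> (\<rho> n)) \<le> cmod a * cmod \<omega> ^ n * B"
        by (intro mult_left_mono B) auto
      finally show ?thesis .
    qed
    ultimately have "S k \<le> 0" for k
      by (intro LIMSEQ_le_const[of _ 0 "S k"]) auto
    then have "\<rho> k = q ^ k * \<delta>" for k using S0 d_zero[of k k] by (simp add: order_antisym)
    then show False using escape[OF \<delta>(3)] \<rho>(3) by (metis abs_ge_self leD order_trans)
  next
    case True
    text \<open>The nonzero digits have bounded gaps, and \<open>c\<close> tends to zero along them, hence some power
      \<open>\<omega> ^ k\<close> with \<open>k > 0\<close> is real.\<close>
    define r where "r = Min (abs ` range \<rho>)"
    have fin: "finite (abs ` range \<rho>)"
      by (rule finite_imageI, rule finite_subset[OF _ R(1)]) (use R(2) in blast)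
    have r_le: "r \<le> \<bar>\<rho> n\<bar>" for n unfolding r_def using fin by (intro Min_le) auto
    have "r \<in> abs ` range \<rho>" unfolding r_def using fin by (intro Min_in) auto
    then have "r > 0" using nz by auto
    then obtain L where L: "q ^ L * r > ?M" using escape by blast
    \<comment> \<open>A run of \<open>L\<close> zero digits would multiply a remainder of modulus at
      least \<open>r\<close> by \<open>q ^ L\<close> and push it out of its bounds.\<close>
    have gap: "\<exists>j. n \<le> j \<and> j < n + L \<and> d j \<noteq> 0" for n
    proof (rule ccontr)
      assume "\<not> ?thesis"
      then have "\<rho> (n + k) = q ^ k * \<rho> n" if "k \<le> L" for k
        using that by (induction k) (auto simp: \<rho>(2))
      then have "q ^ L * \<bar>\<rho> n\<bar> \<le> ?M" using \<rho>(3)[of "n + L"] q by (simp add: abs_mult)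
      moreover have "q ^ L * r \<le> q ^ L * \<bar>\<rho> n\<bar>" using r_le q by (intro mult_left_mono) auto
      ultimately show False using L by linarith
    qed
    \<comment> \<open>A real power of \<omega> would be 1 or -1, making \<open>p\<close> a root of
      unity.\<close>
    have Im: "Im (\<omega> ^ k) \<noteq> 0" if "k > 0" for k
    proof
      assume *: "Im (\<omega> ^ k) = 0"
      moreover have "cmod (\<omega> ^ k) = 1" by (simp add: norm_power True)
      ultimately have "\<bar>Re (\<omega> ^ k)\<bar> = 1" by (simp add: cmod_def)
      then have "(Re (\<omega> ^ k))\<^sup>2 = 1" by (metis one_power2 power2_abs)
      with * have "(\<omega> ^ k)\<^sup>2 = 1" by (simp add: complex_eq_iff power2_eq_square)
      then have "\<omega> ^ (2 * k) = 1" by (metis mult.commute power_mult)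
      then have "p ^ (2 * k) = 1"
        using \<omega>(3) by (metis mult.right_neutral power_mult_distrib power_one)
      then show False using root_of_unity[OF q(1), of "2 * k"] that by simp
    qed
    define \<eta> where "\<eta> = Min ((\<lambda>k. \<bar>Im (\<omega> ^ k)\<bar>) ` {1..L})"
    have "L > 0" using gap[of 0] by auto
    then have "\<eta> \<in> (\<lambda>k. \<bar>Im (\<omega> ^ k)\<bar>) ` {1..L}" unfolding \<eta>_def by (intro Min_in) auto
    then have \<eta>: "\<eta> > 0" using Im by auto
    have \<eta>_le: "\<eta> \<le> \<bar>Im (\<omega> ^ k)\<bar>" if "1 \<le> k" "k \<le> L" for k
      unfolding \<eta>_def using that by (intro Min_le) auto
    \<comment> \<open>The value gives \<open>\<tau> * (\<eta> + 2) = cmod a * \<eta> / 2\<close>.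
      Two nonzero digits at distance \<open>k \<le> L\<close> make \<open>Re b\<close> and
      \<open>Re (b * \<omega> ^ k)\<close> smaller than \<tau>, which is too small for
      \<open>cmod b = cmod a\<close>.\<close>
    define \<tau> where "\<tau> = cmod a * \<eta> / (2 * (\<eta> + 2))"
    have "a \<noteq> 0" using a by auto
    then have \<tau>: "\<tau> > 0" using \<eta> by (simp add: \<tau>_def)
    have "summable (\<lambda>i. \<bar>of_int (d i) * c i\<bar>)"
    proof (rule summableI_nonneg_bounded)
      fix n
      have "cmod a * cmod (\<kappa> (\<rho> n)) \<le> cmod a * B" by (intro mult_left_mono B) auto
      then show "(\<Sum>i<n. \<bar>of_int (d i) * c i\<bar>) \<le> cmod a * B" using S[of n] by (simp add: S_def True)
    qed auto
    then have "(\<lambda>i. \<bar>of_int (d i) * c i\<bar>) \<longlonglongrightarrow> 0" by (rule summable_LIMSEQ_zero)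
    then have "\<forall>\<^sub>F i in sequentially. \<bar>of_int (d i) * c i\<bar> < \<tau>" using \<tau> by (rule order_tendstoD)
    then obtain n where n: "\<And>i. i \<ge> n \<Longrightarrow> \<bar>of_int (d i) * c i\<bar> < \<tau>"
      unfolding eventually_sequentially by blast
    have c_small: "\<bar>c i\<bar> < \<tau>" if "i \<ge> n" "d i \<noteq> 0" for i
    proof -
      have "1 * \<bar>c i\<bar> \<le> \<bar>of_int (d i)\<bar> * \<bar>c i\<bar>" using that(2) by (intro mult_right_mono) auto
      then show ?thesis using n[OF that(1)] by (simp add: abs_mult)
    qed
    obtain j where j: "n \<le> j" "d j \<noteq> 0" using gap by blast
    obtain i where i: "Suc j \<le> i" "i < Suc j + L" "d i \<noteq> 0" using gap by blast
    define b where "b = a * \<omega> ^ Suc j"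
    define k where "k = i - j"
    have "i = j + k" "1 \<le> k" "k \<le> L" using i by (auto simp: k_def)
    then have ci: "c i = Re (b * \<omega> ^ k)" by (simp add: c_def b_def power_add mult_ac)
    have cj: "c j = Re b" by (simp add: c_def b_def)
    have b: "cmod b = cmod a" by (simp add: b_def norm_mult norm_power True)
    have "\<bar>Re (\<omega> ^ k)\<bar> \<le> 1" using abs_Re_le_cmod[of "\<omega> ^ k"] by (simp add: norm_power True)
    then have "\<bar>Re b\<bar> * \<bar>Re (\<omega> ^ k)\<bar> \<le> \<bar>Re b\<bar> * 1" by (intro mult_left_mono) auto
    then have "\<bar>Re b * Re (\<omega> ^ k)\<bar> \<le> \<tau>" using c_small[OF j] cj by (simp add: abs_mult)
    moreover have "Im b * Im (\<omega> ^ k) = Re b * Re (\<omega> ^ k) - c i" unfolding ci by simp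
    moreover have "\<bar>c i\<bar> < \<tau>" using c_small i j by simp
    ultimately have "\<bar>Im b\<bar> * \<bar>Im (\<omega> ^ k)\<bar> \<le> 2 * \<tau>" unfolding abs_mult[symmetric] by linarith
    moreover have "\<bar>Im b\<bar> * \<eta> \<le> \<bar>Im b\<bar> * \<bar>Im (\<omega> ^ k)\<bar>"
      using \<eta>_le \<open>1 \<le> k\<close> \<open>k \<le> L\<close> by (intro mult_left_mono) auto
    moreover have "cmod a * \<eta> \<le> (\<bar>Re b\<bar> + \<bar>Im b\<bar>) * \<eta>"
      unfolding b[symmetric] using \<eta> by (intro mult_right_mono cmod_le) auto
    moreover have "\<bar>Re b\<bar> * \<eta> \<le> \<tau> * \<eta>" using c_small[OF j] cj \<eta> by (intro mult_right_mono) auto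
    ultimately have "cmod a * \<eta> \<le> \<tau> * (\<eta> + 2)" by (simp add: algebra_simps)
    also have "\<dots> = cmod a * \<eta> / 2" using \<eta> by (simp add: \<tau>_def field_simps)
    finally show False using \<eta> \<open>a \<noteq> 0\<close> by simp
  qed
qed

end

subsection \<open>Discrete spectra and Pisot numbers\<close>

lemma remainder_digit_diffs:
  assumes "m > 0" "z 0 = 1" "\<And>n. z (Suc n) = q * z n - of_int (d n)" "\<And>n. \<bar>d n\<bar> \<le> int m"
  shows "z n \<in> digit_diffs m q (Suc n)"
proof (induction n)
  case 0
  show ?case using digit_diffs_digit[of 1 m q] assms by simp
next
  case (Suc n)
  show ?case using digit_diffs_shift[OF Suc, of "- d n"] assms(4)[of n] by (simp add: assms(3))
qed

lemma expansion_of_one: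
  assumes q: "q > 1" "real m \<ge> q - 1" "m > 0"
    and fin: "\<And>C. finite {y \<in> (\<Union>n. digit_diffs m q n). \<bar>y\<bar> \<le> C}"
  obtains z :: "nat \<Rightarrow> real" and d :: "nat \<Rightarrow> int"
  where "z 0 = 1" "\<And>n. z (Suc n) = q * z n - of_int (d n)" "\<And>n. 0 \<le> z n" "finite (range z)"
proof -
  obtain z e where z: "z 0 = 1" "\<And>n. z (Suc n) = q * z n - real (e n) \<and> e n \<le> m \<and> 0 \<le> z n \<and> z n \<le> real m / (q - 1)"
    using digit_expansion[OF q(1,2), of 1] q by auto
  have "z n \<in> digit_diffs m q (Suc n)" for n
    by (rule remainder_digit_diffs[where d = "\<lambda>n. int (e n)"]) (use q z in auto)
  then have "range z \<subseteq> {y \<in> (\<Union>n. digit_diffs m q n). \<bar>y\<bar> \<le> real m / (q - 1)}"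
    using z by force
  then have "finite (range z)" using fin finite_subset by blast
  then show thesis by (intro that[of z "\<lambda>n. int (e n)"]) (use z in auto)
qed

text \<open>\<open>F n\<close> is the monic integer polynomial of degree \<open>n\<close> with value
  \<open>z n\<close> at \<open>q\<close>. A repetition \<open>z i = z j\<close> with
  \<open>i < j\<close> makes \<open>q\<close> a root of the monic polynomial
  \<open>F j - F i\<close>.\<close>

lemma algebraic_int_if_finite_remainders:
  fixes z :: "nat \<Rightarrow> real" and d :: "nat \<Rightarrow> int"
  assumes z: "z 0 = 1" "\<And>n. z (Suc n) = q * z n - of_int (d n)" and fin: "finite (range z)"
  shows "algebraic_int q"
proof -
  define F :: "nat \<Rightarrow> int poly" where "F = rec_nat 1 (\<lambda>n f. pCons (- d n) f)"
  have F: "F 0 = 1" "F (Suc n) = pCons (- d n) (F n)" for n by (simp_all add: F_def)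
  have lead: "degree (F n) = n \<and> coeff (F n) n = 1" for n
    by (induction n) (auto simp: F degree_pCons_eq_if)
  have ev: "poly (map_poly of_int (F n)) q = z n" for n
    by (induction n) (auto simp: F z map_poly_pCons)
  have "\<not> inj z" using fin range_inj_infinite by blast
  then obtain i j where ij: "i < j" "z i = z j" by (metis injI linorder_neqE_nat)
  have deg: "degree (F j - F i) = j"
    using lead[of i] lead[of j] ij(1) by (intro antisym degree_diff_le le_degree) (auto simp: coeff_eq_0)
  then have "lead_coeff (F j - F i) = 1"
    using lead[of i] lead[of j] ij(1) by (simp add: coeff_eq_0)
  moreover have "map_poly of_int (F j - F i) = (map_poly of_int (F j) - map_poly of_int (F i) :: real poly)"
    by (intro poly_eqI) (simp add: coeff_map_poly)
  then have "poly (map_poly of_int (F j - F i)) q = 0" by (simp add: ev ij)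
  ultimately show ?thesis unfolding algebraic_int_altdef_ipoly by blast
qed

context conjugation
begin

text \<open>For real \<open>p > 1\<close> the sum in \<open>conj_remainder_minus\<close> has
  nonnegative terms, the first being a power of \<open>p\<close>, so it is unbounded; finitely many
  remainders allow only a bounded left-hand side.\<close>

lemma not_real_conjugate:
  assumes q: "q > 1" and p: "cmod p \<ge> 1" "Im p = 0" "Re p > 0" "p \<noteq> of_real q"
    and z: "z 0 = 1" "\<And>n. z (Suc n) = q * z n - of_int (d n)" "\<And>n. 0 \<le> z n" "finite (range z)"
  shows False
proof -
  obtain r where r: "p = of_real r" using p(2) by (metis complex_is_Real_iff Reals_cases)
  have "p \<noteq> 1" using root_of_unity[OF q, of 1] by auto
  then have r1: "r > 1" using p r by (cases "r = 1") auto
  have "finite ((\<lambda>y. cmod (\<kappa> y - of_real y)) ` range z)" using z(4) by simp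
  then obtain B where B: "cmod (\<kappa> (z n) - of_real (z n)) \<le> B" for n using Max_ge by blast
  obtain n where n: "B / \<bar>r - q\<bar> < r ^ n" using real_arch_pow[OF r1] by blast
  have "r ^ n \<le> (\<Sum>j<Suc n. z j * r ^ (Suc n - Suc j))"
    using member_le_sum[of 0 "{..<Suc n}" "\<lambda>j. z j * r ^ (Suc n - Suc j)"] z r1 by simp
  then have "\<bar>r - q\<bar> * r ^ n \<le> \<bar>r - q\<bar> * \<bar>\<Sum>j<Suc n. z j * r ^ (Suc n - Suc j)\<bar>"
    by (intro mult_left_mono) auto
  also have "\<dots> = cmod (of_real ((r - q) * (\<Sum>j<Suc n. z j * r ^ (Suc n - Suc j))))"
    by (simp only: norm_of_real abs_mult)
  also have "\<dots> = cmod (\<kappa> (z (Suc n)) - of_real (z (Suc n)))"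
    unfolding conj_remainder_minus[of z d, OF z(1,2)] r by simp
  also have "\<dots> \<le> B" by (rule B)
  finally show False using n p(4) r by (simp add: pos_divide_less_eq mult.commute)
qed

text \<open>Since \<open>\<kappa>\<close> fixes the rational number \<open>q * z n\<close>, also
  \<open>p * \<kappa> (z n) = q * z n\<close>. Dividing the resulting identity by
  \<open>p - q\<close> leaves a polynomial with the decreasing coefficients \<open>z j\<close> and
  root \<open>inverse p\<close>.\<close>

lemma greedy_contradiction:
  assumes q: "q > 1" "m > 0" "real m \<le> q" "q < real m + 1"
    and p: "cmod p \<ge> 1" "p \<noteq> of_real q"
    and z: "z 0 = 1" "\<And>n. z (Suc n) = q * z n - real m"
    and n: "0 \<le> z n" "\<And>j. j < n \<Longrightarrow> z (Suc j) \<le> z j" "q * z n \<in> \<rat>"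
  shows False
proof -
  have p0: "p \<noteq> 0" using p by auto
  have z': "z (Suc n) = q * z n - of_int (int m)" for n by (simp add: z)
  have zG: "z n \<in> G" using remainder_mem[of z "\<lambda>_. int m", OF _ z'] by (simp add: z one_mem)
  obtain r where r: "q * z n = of_rat r" using n(3) by (auto elim: Rats_cases)
  have "p * \<kappa> (z n) = of_real (q * z n)"
  proof -
    have "(of_rat r :: complex) = of_real (of_rat r)" by (cases r) (simp add: of_rat_rat)
    then show ?thesis using conj_mult[OF zG] conj_of_rat[of r] by (simp add: r)
  qed
  then have "0 = p * (\<kappa> (z n) - of_real (z n)) + (p - of_real q) * of_real (z n)"
    by (simp add: algebra_simps)
  also have "\<dots> = (p - of_real q) * (p * (\<Sum>j<n. of_real (z j) * p ^ (n - Suc j)) + of_real (z n))"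
    unfolding conj_remainder_minus[of z "\<lambda>_. int m", OF z(1) z'] by (simp add: algebra_simps)
  also have "p * (\<Sum>j<n. of_real (z j) * p ^ (n - Suc j)) = (\<Sum>j<n. of_real (z j) * p ^ (n - j))"
    unfolding sum_distrib_left by (intro sum.cong) (auto simp: Suc_diff_Suc simp flip: power_Suc)
  also have "(\<Sum>j<n. of_real (z j) * p ^ (n - j)) + of_real (z n) = (\<Sum>j\<le>n. of_real (z j) * p ^ (n - j))"
    by (simp flip: lessThan_Suc_atMost)
  also have "\<dots> = p ^ n * (\<Sum>j\<le>n. of_real (z j) * inverse p ^ j)"
    unfolding sum_distrib_left using p0
    by (intro sum.cong) (auto simp: power_diff field_simps)
  finally have root: "(\<Sum>j\<le>n. of_real (z j) * inverse p ^ j) = 0" using p p0 by simp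
  have "p \<noteq> 1" using root_of_unity[OF q(1), of 1] by auto
  then have "inverse p \<noteq> 1" by simp
  moreover have "cmod (inverse p) \<le> 1" using p by (simp add: norm_inverse inverse_le_1_iff)
  moreover have "z 1 < z 0" using q z(1) z(2)[of 0] by simp
  ultimately show False
    using enestrom_kakeya[of "inverse p" z n] root n z by simp
qed

end

lemma Pisot_number_if_discrete:
  assumes q: "q > 1" "m > 0" "real m \<le> q" "q < real m + 1"
    and fin: "\<And>C. finite {y \<in> (\<Union>n. digit_diffs m q n). \<bar>y\<bar> \<le> C}"
  shows "Pisot_number q"
proof -
  let ?M = "real m / (q - 1)"
  have M: "?M > 1" "real m \<ge> q - 1" using q by auto
  obtain y :: "nat \<Rightarrow> real" and d :: "nat \<Rightarrow> int" where
    y: "y 0 = 1" "\<And>n. y (Suc n) = q * y n - of_int (d n)" "\<And>n. 0 \<le> y n" "finite (range y)"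
    using expansion_of_one[OF q(1) M(2) q(2) fin] by blast
  have "cmod p < 1" if conj: "algebraic_conjugate (of_real q) p" and ne: "p \<noteq> of_real q" for p
  proof (rule ccontr)
    assume "\<not> cmod p < 1"
    then have p: "cmod p \<ge> 1" by simp
    obtain G \<kappa> where "conjugation q p G \<kappa>" using conjugation_exists[OF conj] .
    then interpret conjugation q p G \<kappa> .
    have p': "\<not> (Im p = 0 \<and> Re p > 0)" using not_real_conjugate[of y d] q(1) p ne y by blast
    define z where "z = rec_nat 1 (\<lambda>_ x. q * x - real m)"
    have z: "z 0 = 1" "z (Suc n) = q * z n - real m" for n by (simp_all add: z_def)
    \<comment> \<open>\<open>m / (q - 1)\<close> is the repelling fixed point of
      \<open>x \<mapsto> q * x - m\<close>; starting at 1, below it, the sequence decreases without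
      bound.\<close>
    have closed: "?M - z n = q ^ n * (?M - 1)" for n
    proof (induction n)
      case (Suc n)
      have "?M - z (Suc n) = q * (?M - z n)" using q by (simp add: z field_simps)
      then show ?case using Suc by simp
    qed (simp add: z)
    have dec: "z (Suc n) \<le> z n" for n
    proof -
      have "q ^ n * (?M - 1) \<le> q ^ Suc n * (?M - 1)" using M q by (intro mult_right_mono) auto
      then show ?thesis using closed[of n] closed[of "Suc n"] by linarith
    qed
    obtain n where "z n < real m / q"
    proof -
      obtain n where "?M / (?M - 1) < q ^ n" using real_arch_pow q(1) by blast
      moreover have "?M - 1 > 0" using M by simp
      ultimately have "?M < ?M - z n" unfolding closed by (simp only: pos_divide_less_eq)
      then have "z n < 0" by simp
      moreover have "0 \<le> real m / q" using q by simp
      ultimately show thesis by (intro that[of n]) linarith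
    qed
    \<comment> \<open>Before index \<open>k\<close> the remainders are at least
      \<open>m / q\<close>, so subtracting the digit \<open>m\<close> keeps them nonnegative up to
      \<open>z k\<close>.\<close>
    define k where "k = (LEAST n. z n < real m / q)"
    have k: "z k < real m / q" unfolding k_def by (rule LeastI) fact
    have zk: "0 \<le> z k"
    proof (cases k)
      case 0
      then show ?thesis by (simp add: z)
    next
      case (Suc j)
      have "\<not> z j < real m / q" using not_less_Least[of j "\<lambda>n. z n < real m / q"] Suc by (simp add: k_def)
      then show ?thesis using q by (simp add: Suc z field_simps)
    qed
    define e where "e = \<lfloor>q * z k\<rfloor>"
    define t where "t = q * z k - of_int e"
    have "q * z k < real m" using k q by (simp add: field_simps)
    \<comment> \<open>Since \<open>e < m\<close>, both \<open>e\<close> and \<open>e + 1\<close> are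
      digits, which makes both \<open>t\<close> and \<open>1 - t\<close> digit differences.\<close>
    then have e: "0 \<le> e" "e < int m" using zk q by (auto simp: e_def floor_less_iff)
    have t: "0 \<le> t" "t < 1" unfolding t_def e_def by linarith+
    have zY: "z k \<in> digit_diffs m q (Suc k)"
      by (rule remainder_digit_diffs[where d = "\<lambda>_. int m"]) (use q z in auto)
    have tY: "t \<in> digit_diffs m q (Suc (Suc k))"
      using digit_diffs_shift[OF zY, of "- e"] e by (simp add: t_def)
    have "q * z k + of_int (- e - 1) \<in> digit_diffs m q (Suc (Suc k))"
      by (rule digit_diffs_shift[OF zY]) (use e in linarith)
    moreover have "1 - t = - (q * z k + of_int (- e - 1))" unfolding t_def by simp
    ultimately have tY': "1 - t \<in> digit_diffs m q (Suc (Suc k))" by (simp only: digit_diffs_minus)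
    have zG: "z k \<in> G"
      by (rule remainder_mem[where d = "\<lambda>_. int m"]) (simp_all add: z one_mem)
    have tG: "t \<in> G" unfolding t_def by (intro diff_mem mult_mem zG of_int_mem)
    show False
    proof (cases "t \<in> \<rat>")
      case True
      then have "q * z k \<in> \<rat>" using Rats_add[OF True, of "of_int e"] by (simp add: t_def)
      then show False by (rule greedy_contradiction[OF q p ne z zk dec])
    next
      case False
      have "\<exists>\<delta>\<in>G. finite_offsets m q \<delta> \<and> 0 < \<delta> \<and> \<delta> < \<epsilon>" if "\<epsilon> > 0" for \<epsilon>
      proof -
        have "\<exists>\<delta>\<in>{\<delta> \<in> G. finite_offsets m q \<delta>}. 0 < \<delta> \<and> \<delta> < \<epsilon>"
        proof (rule euclid_small[of _ t])
          fix a b assume ab: "a \<in> {\<delta> \<in> G. finite_offsets m q \<delta>}" "b \<in> {\<delta> \<in> G. finite_offsets m q \<delta>}"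
            "0 < b" "b < a" "a + b \<le> 1"
          then have "finite_offsets m q (a - b)"
            by (intro finite_offsets_diff[OF q(1) M(2)] order_trans[OF _ less_imp_le[OF M(1)]]) simp_all
          then show "a - b \<in> {\<delta> \<in> G. finite_offsets m q \<delta>}" using ab(1,2) diff_mem by blast
        next
          show "t \<in> {\<delta> \<in> G. finite_offsets m q \<delta>}"
            using finite_offsets_digit_diffs[OF fin tY] tG by simp
          show "1 - t \<in> {\<delta> \<in> G. finite_offsets m q \<delta>}"
            using finite_offsets_digit_diffs[OF fin tY'] diff_mem[OF one_mem tG] by simp
          show "0 < t" using t(1) False by (cases "t = 0") simp_all
        qed (use t False that in simp_all)
        then show ?thesis by blast
      qed
      then show False by (rule aligned_contradiction[OF q(1) M(2) q(2) p p'])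
    qed
  qed
  moreover have "algebraic_int q" using algebraic_int_if_finite_remainders[of y q d] y by blast
  ultimately show ?thesis using q unfolding Pisot_number_def by blast
qed

text \<open>Otherwise distinct digit differences for \<open>k = \<lfloor>q\<rfloor> \<le> m\<close>
  are at least \<open>\<epsilon>\<close> apart, hence locally finite, and \<open>q\<close> would be
  Pisot.\<close>

lemma small_digit_diffs:
  assumes q: "q > 1" "real m > q - 1" and np: "\<not> Pisot_number q" and \<epsilon>: "\<epsilon> > 0"
  shows "\<exists>n. \<exists>y\<in>digit_diffs (2 * m) q n. 0 < y \<and> y < \<epsilon>"
proof (rule ccontr)
  assume none: "\<not> ?thesis"
  define k where "k = nat \<lfloor>q\<rfloor>"
  have k: "real k \<le> q" "q < real k + 1" "k > 0" using q by (auto simp: k_def le_nat_floor)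
  have "k \<le> m" using k q by linarith
  have "finite {y \<in> (\<Union>n. digit_diffs k q n). \<bar>y\<bar> \<le> C}" for C
  proof -
    have sep: "\<epsilon> \<le> \<bar>x - y\<bar>" if x: "x \<in> digit_diffs k q i" and y: "y \<in> digit_diffs k q j" and "x \<noteq> y" for x y i j
    proof -
      have "x - y \<in> digit_diffs (2 * m) q (max i j)"
        using digit_diffs_diff[OF x y] digit_diffs_le_digits[of "2 * k" "2 * m"] \<open>k \<le> m\<close> by auto
      then have "\<bar>x - y\<bar> \<in> digit_diffs (2 * m) q (max i j)"
        using digit_diffs_minus[of "x - y"] by (cases "x < y") (simp_all add: abs_if)
      then show ?thesis using none \<open>x \<noteq> y\<close> by (meson linorder_not_le zero_less_abs_iff right_minus_eq)
    qed
    let ?Y = "{y \<in> (\<Union>n. digit_diffs k q n). \<bar>y\<bar> \<le> C}"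
    have "inj_on (\<lambda>y. \<lfloor>y / \<epsilon>\<rfloor>) ?Y"
    proof (rule inj_onI, rule ccontr)
      fix x y assume "x \<in> ?Y" "y \<in> ?Y" and eq: "\<lfloor>x / \<epsilon>\<rfloor> = \<lfloor>y / \<epsilon>\<rfloor>" and "x \<noteq> y"
      then have "\<epsilon> \<le> \<bar>x - y\<bar>" using sep by auto
      moreover have "\<bar>x / \<epsilon> - y / \<epsilon>\<bar> < 1" using eq by linarith
      then have "\<bar>x - y\<bar> < \<epsilon>" using \<epsilon> by (simp flip: diff_divide_distrib)
      ultimately show False by simp
    qed
    moreover have "\<lfloor>y / \<epsilon>\<rfloor> \<in> {\<lfloor>- C / \<epsilon>\<rfloor>..\<lfloor>C / \<epsilon>\<rfloor>}" if "\<bar>y\<bar> \<le> C" for y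
    proof -
      have "- C / \<epsilon> \<le> y / \<epsilon>" "y / \<epsilon> \<le> C / \<epsilon>" using \<epsilon> that by (intro divide_right_mono; simp)+
      then show ?thesis by (simp add: floor_mono del: divide_minus_left)
    qed
    then have "(\<lambda>y. \<lfloor>y / \<epsilon>\<rfloor>) ` ?Y \<subseteq> {\<lfloor>- C / \<epsilon>\<rfloor>..\<lfloor>C / \<epsilon>\<rfloor>}" by blast
    ultimately show ?thesis by (meson finite_atLeastAtMost_int finite_imageD finite_subset)
  qed
  then show False using Pisot_number_if_discrete[of q k] q k np by blast
qed

subsection \<open>The gaps of the spectrum\<close>

text \<open>A tiny difference \<open>a - b\<close>, scaled by a power of \<open>q\<close>, becomes a
  step in \<open>[\<epsilon> / q, \<epsilon>)\<close>. Adding the scaled \<open>b\<close> to the old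
  chain and the scaled \<open>a\<close> to its last element extends the chain by this step.\<close>

lemma chain_exists:
  assumes q: "q > 1" and small: "\<And>\<epsilon>. \<epsilon> > 0 \<Longrightarrow> \<exists>n. \<exists>y\<in>digit_diffs m q n. 0 < y \<and> y < \<epsilon>" and \<epsilon>: "\<epsilon> > 0"
  shows "\<exists>n (c :: nat \<Rightarrow> real). (\<forall>j\<le>k. c j \<in> digit_sums m q n) \<and> (\<forall>j<k. \<epsilon> / q \<le> c (Suc j) - c j \<and> c (Suc j) - c j < \<epsilon>)"
proof (induction k)
  case 0
  show ?case using digit_sums_zero by (intro exI[of _ 0] exI[of _ "\<lambda>_. 0"]) auto
next
  case (Suc k)
  then obtain n c where c: "\<And>j. j \<le> k \<Longrightarrow> c j \<in> digit_sums m q n"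
    "\<And>j. j < k \<Longrightarrow> \<epsilon> / q \<le> c (Suc j) - c j \<and> c (Suc j) - c j < \<epsilon>" by blast
  \<comment> \<open>Below this bound the scaling exponent is at least \<open>n\<close>, so the new
    digits do not overlap the old ones.\<close>
  have "\<epsilon> / q ^ Suc n > 0" using q \<epsilon> by simp
  then obtain l y where y: "y \<in> digit_diffs m q l" "0 < y" "y < \<epsilon> / q ^ Suc n" using small by blast
  then obtain a b where ab: "a \<in> digit_sums m q l" "b \<in> digit_sums m q l" "y = a - b"
    unfolding digit_diffs_def by blast
  have "\<exists>i. \<epsilon> \<le> q ^ i * y"
    using real_arch_pow[OF q, of "\<epsilon> / y"] y(2) by (auto simp: pos_divide_less_eq intro: less_imp_le)
  define i where "i = (LEAST i. \<epsilon> \<le> q ^ i * y)"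
  have i: "\<epsilon> \<le> q ^ i * y" unfolding i_def by (rule LeastI_ex) fact
  have "Suc n < i"
  proof (rule ccontr)
    assume "\<not> ?thesis"
    then have "q ^ i * y \<le> q ^ Suc n * y" using q y(2) by (intro mult_right_mono power_increasing) auto
    also have "\<dots> < \<epsilon>" using y(3) q by (simp add: pos_less_divide_eq mult.commute)
    finally show False using i by simp
  qed
  then obtain s where s: "i = Suc s" "n \<le> s" by (cases i) auto
  have "\<not> \<epsilon> \<le> q ^ s * y" using not_less_Least[of s "\<lambda>i. \<epsilon> \<le> q ^ i * y"] by (simp add: i_def[symmetric] s)
  then have step: "\<epsilon> / q \<le> q ^ s * y" "q ^ s * y < \<epsilon>"
    using i q by (auto simp: s pos_divide_le_eq mult_ac)
  define c' where "c' j = (if j \<le> k then c j + q ^ s * b else c k + q ^ s * a)" for j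
  have cs: "c j \<in> digit_sums m q s" if "j \<le> k" for j using c(1)[OF that] digit_sums_mono[OF s(2)] by blast
  have "\<forall>j\<le>Suc k. c' j \<in> digit_sums m q (s + l)"
    by (auto simp: c'_def intro!: digit_sums_append cs ab)
  moreover have "\<epsilon> / q \<le> c' (Suc j) - c' j \<and> c' (Suc j) - c' j < \<epsilon>" if "j < Suc k" for j
  proof (cases "j < k")
    case True
    then show ?thesis using c(2)[of j] by (simp add: c'_def)
  next
    case False
    then have "j = k" using that by simp
    then have "c' (Suc j) - c' j = q ^ s * y" by (simp add: c'_def ab(3) algebra_simps)
    then show ?thesis using step by simp
  qed
  ultimately show ?case by blast
qed

lemma lower_gap_eq_0:
  assumes q: "q > 1" "m > 0" and small: "\<And>\<epsilon>. \<epsilon> > 0 \<Longrightarrow> \<exists>n. \<exists>y\<in>digit_diffs m q n. 0 < y \<and> y < \<epsilon>"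
  shows "lower_gap m q = 0"
proof (rule antisym)
  let ?x = "spectrum_seq m q"
  note mono = spectrum_seq(1)[OF q] and range = spectrum_seq(2)[OF q]
  show "0 \<le> lower_gap m q"
    unfolding lower_gap_def using mono
    by (intro Liminf_bounded always_eventually) (auto simp: strict_mono_def intro: less_imp_le)
  show "lower_gap m q \<le> 0"
  proof (rule ccontr)
    assume "\<not> ?thesis"
    then obtain c where c: "0 < ereal c" "ereal c < lower_gap m q" using ereal_dense2[of 0 "lower_gap m q"] by (metis not_le)
    then have "\<forall>\<^sub>F k in sequentially. ereal c < ereal (?x (Suc k) - ?x k)"
      unfolding lower_gap_def by (intro less_LiminfD)
    then obtain K where K: "\<And>k. k \<ge> K \<Longrightarrow> c < ?x (Suc k) - ?x k"
      by (auto simp: eventually_sequentially)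
    obtain n a b where ab: "a \<in> digit_sums m q n" "b \<in> digit_sums m q n" "0 < a - b" "a - b < c"
      using small[of c] c(1) unfolding digit_diffs_def by auto
    obtain N where N: "?x K < q ^ N" using real_arch_pow q(1) by blast
    \<comment> \<open>A digit 1 at position \<open>s\<close> moves the close pair \<open>b\<close>,
      \<open>a\<close> beyond the element with index \<open>K\<close>.\<close>
    define s where "s = max n N"
    have "q ^ N \<le> q ^ s" using q by (intro power_increasing) (auto simp: s_def)
    have top: "u + q ^ s \<in> spectrum_set m q" if "u \<in> digit_sums m q n" for u
    proof -
      have "u \<in> digit_sums m q s" using that digit_sums_mono[of n s] by (auto simp: s_def)
      from digit_sums_append[OF this digit_sums_single[of 1]] q show ?thesis
        unfolding spectrum_set_eq by auto
    qed
    obtain i j where ij: "b + q ^ s = ?x i" "a + q ^ s = ?x j"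
      using top[OF ab(1)] top[OF ab(2)] unfolding range[symmetric] by blast
    have "?x K < ?x i" using N \<open>q ^ N \<le> q ^ s\<close> digit_sums_bounds(1)[OF q(1) ab(2)] ij by linarith
    moreover have "?x i < ?x j" using ab ij by linarith
    ultimately have "K < i" "i < j" using mono by (simp_all add: strict_mono_less)
    then have "?x (Suc i) \<le> ?x j" using mono by (simp add: strict_mono_less_eq)
    then show False using K[of i] \<open>K < i\<close> ab(4) ij by simp
  qed
qed

lemma upper_gap_eq_0:
  assumes q: "q > 1" "m > 0" and dense: "\<And>\<epsilon>. \<epsilon> > 0 \<Longrightarrow> \<exists>T. \<forall>x\<ge>T. \<exists>y\<in>spectrum_set m q. x < y \<and> y \<le> x + \<epsilon>"
  shows "upper_gap m q = 0"
proof (rule antisym)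
  let ?x = "spectrum_seq m q"
  note mono = spectrum_seq(1)[OF q] and range = spectrum_seq(2)[OF q]
  show "0 \<le> upper_gap m q"
    unfolding upper_gap_def using mono
    by (intro le_Limsup always_eventually) (auto simp: strict_mono_def intro: less_imp_le)
  show "upper_gap m q \<le> 0"
  proof (rule ccontr)
    assume "\<not> ?thesis"
    then obtain c where c: "0 < ereal c" "ereal c < upper_gap m q" using ereal_dense2[of 0 "upper_gap m q"] by (metis not_le)
    then obtain T where T: "\<And>x. x \<ge> T \<Longrightarrow> \<exists>y\<in>spectrum_set m q. x < y \<and> y \<le> x + c"
      using dense[of c] by auto
    then obtain k0 where k0: "T < ?x k0" unfolding range[symmetric] by blast
    have "?x (Suc k) - ?x k \<le> c" if "k \<ge> k0" for k
    proof -
      have "?x k0 \<le> ?x k" using that mono by (simp add: strict_mono_less_eq)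
      then obtain j where j: "?x k < ?x j" "?x j \<le> ?x k + c"
        using T[of "?x k"] k0 unfolding range[symmetric] by force
      then have "k < j" using mono by (simp add: strict_mono_less)
      then have "?x (Suc k) \<le> ?x j" using mono by (simp add: strict_mono_less_eq)
      then show ?thesis using j by simp
    qed
    then have "\<forall>\<^sub>F k in sequentially. ereal (?x (Suc k) - ?x k) \<le> ereal c"
      by (auto simp: eventually_sequentially)
    then have "upper_gap m q \<le> ereal c" unfolding upper_gap_def by (rule Limsup_bounded)
    then show False using c by simp
  qed
qed

text \<open>A chain in \<open>digit_sums k q n\<close> that is longer than every gap of the spectrum for the digits up to
  \<open>m\<close>, translated by the elements of the latter, leaves no gap longer than its steps.\<close>

lemma spectrum_set_eventually_dense:
  assumes q: "q > 1" "m > 0" "real m \<ge> q - 1"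
    and small: "\<And>\<epsilon>. \<epsilon> > 0 \<Longrightarrow> \<exists>n. \<exists>y\<in>digit_diffs k q n. 0 < y \<and> y < \<epsilon>" and \<epsilon>: "\<epsilon> > 0"
  shows "\<exists>T. \<forall>x\<ge>T. \<exists>y\<in>spectrum_set (m + k) q. x < y \<and> y \<le> x + \<epsilon>"
proof -
  let ?M = "real m / (q - 1)"
  have "\<epsilon> / q > 0" using q \<epsilon> by simp
  then obtain l :: nat where l: "?M < real l * (\<epsilon> / q)" using reals_Archimedean3 by blast
  obtain n c where c: "\<And>j. j \<le> l \<Longrightarrow> c j \<in> digit_sums k q n"
    "\<And>j. j < l \<Longrightarrow> \<epsilon> / q \<le> c (Suc j) - c j \<and> c (Suc j) - c j < \<epsilon>"
    using chain_exists[OF q(1) small \<epsilon>, where k = l] by blast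
  have "real j * (\<epsilon> / q) \<le> c j - c 0" if "j \<le> l" for j
    using that
  proof (induction j)
    case (Suc j)
    then have "real j * (\<epsilon> / q) \<le> c j - c 0" "\<epsilon> / q \<le> c (Suc j) - c j" using c(2)[of j] by auto
    moreover have "real (Suc j) * (\<epsilon> / q) = real j * (\<epsilon> / q) + \<epsilon> / q" by (simp add: ring_distribs add_divide_distrib)
    ultimately show ?case by linarith
  qed simp
  then have long: "?M < c l - c 0" using l by force
  have "\<exists>y\<in>spectrum_set (m + k) q. x < y \<and> y \<le> x + \<epsilon>" if x: "x \<ge> c 0" for x
  proof -
    obtain i w where w: "w \<in> digit_sums m q i" "0 \<le> x - c 0 - w" "x - c 0 - w \<le> ?M"
      using spectrum_approx[OF q(1,3,2), of "x - c 0"] x by auto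
    have ex: "x < c l + w" using w long by linarith
    \<comment> \<open>The first chain point beyond \<open>x\<close> is less than
      \<open>\<epsilon>\<close> above its predecessor, which is at most \<open>x\<close>.\<close>
    define j where "j = (LEAST j. x < c j + w)"
    have j: "x < c j + w" unfolding j_def using ex by (rule LeastI)
    have "j \<le> l" unfolding j_def using ex by (rule Least_le)
    have "j \<noteq> 0" using j w by (cases j) auto
    then obtain h where h: "j = Suc h" by (cases j) auto
    have "\<not> x < c h + w" using not_less_Least[of h "\<lambda>j. x < c j + w"] by (simp add: j_def[symmetric] h)
    then have "c j + w \<le> x + \<epsilon>" using c(2)[of h] \<open>j \<le> l\<close> h by auto
    moreover have "w + c j \<in> digit_sums (m + k) q (max i n)"
      using w(1) c(1)[OF \<open>j \<le> l\<close>] digit_sums_mono[of i "max i n"] digit_sums_mono[of n "max i n"]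
      by (intro digit_sums_add) (blast intro: max.cobounded1 max.cobounded2)+
    ultimately show ?thesis using j unfolding spectrum_set_eq
      by (intro bexI[of _ "w + c j"]) (auto simp: add.commute)
  qed
  then show ?thesis by blast
qed

theorem theorem1p3:
  fixes q :: real and m :: nat
  assumes "q > 1" and "\<not> Pisot_number q"
    and "m > 0" and "real m > q - 1"
  shows "lower_gap (2 * m) q = 0 \<and> upper_gap (3 * m) q = 0"
proof
  have small: "\<exists>n. \<exists>y\<in>digit_diffs (2 * m) q n. 0 < y \<and> y < \<epsilon>" if "\<epsilon> > 0" for \<epsilon>
    using small_digit_diffs[OF assms(1,4,2) that] .
  show "lower_gap (2 * m) q = 0"
    by (rule lower_gap_eq_0) (use assms small in auto)
  \<comment> \<open>Digits up to \<open>m\<close> bound the gaps, and digits up to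
    \<open>2 * m\<close> supply the chain that fills them.\<close>
  have "m + 2 * m = 3 * m" by simp
  with spectrum_set_eventually_dense[OF assms(1,3) _ small] assms(4)
  show "upper_gap (3 * m) q = 0"
    by (intro upper_gap_eq_0) (use assms in auto)
qed

end
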